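(* Let $n\ge1$ and $\bm{N}=(N_0,\ldots,N_{n-1},-\sum_{i<n}N_i)\in\mathbb{Z}^{n+1}$ (entries not necessarily nonnegative). Let $s_k=\sum_{j=0}^kN_j$ and, for $1\le k\le n$, $c_k=\frac{N_{n-k}}{k+1}+\frac{s_{n-k}}{k(k+1)}$. (1) If $s_k\ge\max\{0,-(n-k)N_k\}$ for all $k\in\{0,\ldots,n-1\}$, then \[ K_n(\bm{N})\ge\frac1{n^2}\prod_{k=0}^{n-1}\frac{s_k^{s_k}}{(1+s_k)^{1+s_k}}\prod_{k=1}^n\Big(\frac{(c_k+1)^{c_k+1}}{c_k^{c_k}}\Big)^k. \] (2) If $s_k\ge\max\{0,-(n-k)N_k\}$ and $N_k\ge\frac1{n-k}-(n-k+1)$ for all $k\in\{0,\ldots,n-1\}$, then \[ K_n(\bm{N})\ge\frac{1}{n^2e^n(n!)^2}\prod_{k=1}^n\Big(\frac{(c_k+1)^{c_k+1}}{c_k^{c_k}}\Big)^{k-1}. \]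
   Context: $K_n(\bm{N})$ is the number of integer vectors $(f_{ij})_{0\le i<j\le n}\in\mathbb{Z}_{\ge0}^{\binom{n+1}{2}}$ with $\sum_{j>i} f_{ij}-\sum_{k<i} f_{ki}=N_i$ for every $i\in\{0,\ldots,n\}$. Convention $0^0=1$. *)

theory Defs
  imports Complex_Main
begin

text \<open>Flow vectors (f_ij), 0 <= i < j <= n, nonnegative integers, encoded as functions
  on pairs that vanish outside {(i,j). i < j <= n}, with net flow N i at every vertex i <= n.\<close>
definition kostant_vectors :: "nat \<Rightarrow> (nat \<Rightarrow> int) \<Rightarrow> (nat \<times> nat \<Rightarrow> nat) set" where
  "kostant_vectors n N =
     {f. (\<forall>i j. \<not> (i < j \<and> j \<le> n) \<longrightarrow> f (i, j) = 0) \<and>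
         (\<forall>i\<le>n. (\<Sum>j\<in>{i<..n}. int (f (i, j))) - (\<Sum>k<i. int (f (k, i))) = N i)}"

definition kostant_K :: "nat \<Rightarrow> (nat \<Rightarrow> int) \<Rightarrow> nat" where
  "kostant_K n N = card (kostant_vectors n N)"

definition selfpow :: "real \<Rightarrow> real" where
  "selfpow x = (if x = 0 then 1 else x powr x)"

end

theory Submission
  imports Defs
begin

text \<open>
  For every real flow \<open>\<phi> \<ge> 0\<close> with the prescribed net flows, the number of integer flows is at
  least \<open>\<Prod>\<^sub>e g(\<phi>\<^sub>e) / \<Prod>\<^sub>k g(s\<^sub>k)\<close> with \<open>g(x) = (x+1)\<^sup>x\<^sup>+\<^sup>1 / x\<^sup>x\<close>; the theorem is the case of
  the flow that leaves every vertex in equal parts. To see this, the coefficient of \<open>x\<^sup>N\<close> in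
  \<open>\<Prod>\<^sub>i\<^sub><\<^sub>j 1 / (1 - x\<^sub>i / x\<^sub>j)\<close> is extracted one variable at a time. For fixed positive
  values of the remaining variables the coefficients in \<open>x\<^sub>k\<close> form a log-concave sequence that
  starts \<open>s\<^sub>k\<close> places before the wanted one, so each extraction costs at most a factor \<open>g(s\<^sub>k)\<close>
  compared with the value at any positive point, while \<open>1 / (1 - q) \<ge> g(x) q\<^sup>x\<close> bounds each
  edge factor.

  The log-concavity is a discrete Lorentzian property: with \<open>F(\<gamma>)\<close> the weighted number of
  flows of net flow \<open>\<gamma>\<close>, every matrix \<open>F(\<mu> + e\<^sub>i + e\<^sub>j)\<close> has at most one positive eigenvalue.
  This survives the addition of an edge from \<open>x\<close> to \<open>y\<close> of weight \<open>w\<close>, which replaces \<open>F\<close> by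
  the sum of its shifts \<open>w\<^sup>k F(\<gamma> - k (e\<^sub>x - e\<^sub>y))\<close>: the matrices of consecutive shifts agree, up to
  the factor \<open>w\<close>, in the column \<open>y\<close> of the first and \<open>x\<close> of the second.
\<close>

section \<open>Symmetric forms with at most one positive eigenvalue\<close>

definition bil :: "nat set \<Rightarrow> (nat \<Rightarrow> nat \<Rightarrow> real) \<Rightarrow> (nat \<Rightarrow> real) \<Rightarrow> (nat \<Rightarrow> real) \<Rightarrow> real" where
  "bil V a x z = (\<Sum>i\<in>V. \<Sum>j\<in>V. x i * a i j * z j)"

text \<open>For symmetric \<open>a\<close> this says that the form has at most one positive eigenvalue.\<close>
definition lorentz :: "nat set \<Rightarrow> (nat \<Rightarrow> nat \<Rightarrow> real) \<Rightarrow> bool" where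
  "lorentz V a \<longleftrightarrow> (\<forall>x z. bil V a x x > 0 \<longrightarrow> bil V a x x * bil V a z z \<le> (bil V a x z)\<^sup>2)"

lemma bil_sym:
  assumes "\<forall>i j. a i j = a j i"
  shows "bil V a x z = bil V a z x"
proof -
  have "bil V a x z = (\<Sum>i\<in>V. \<Sum>j\<in>V. z j * a j i * x i)"
    unfolding bil_def by (intro sum.cong refl) (use assms in \<open>simp add: mult_ac\<close>)
  also have "\<dots> = bil V a z x"
    unfolding bil_def by (rule sum.swap)
  finally show ?thesis .
qed

lemma bil_diff_right: "bil V a x (\<lambda>i. z i - t * d i) = bil V a x z - t * bil V a x d"
  unfolding bil_def
  by (simp add: algebra_simps sum_subtractf sum_distrib_left)

lemma bil_diff_left: "bil V a (\<lambda>i. z i - t * d i) x = bil V a z x - t * bil V a d x"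
  unfolding bil_def
  by (simp add: algebra_simps sum_subtractf sum_distrib_left)

lemma bil_diff_square:
  assumes "\<forall>i j. a i j = a j i"
  shows "bil V a (\<lambda>i. z i - t * d i) (\<lambda>i. z i - t * d i)
         = bil V a z z - 2 * t * bil V a z d + t\<^sup>2 * bil V a d d"
  using bil_sym[OF assms, of V d z]
  by (simp add: bil_diff_left bil_diff_right power2_eq_square algebra_simps)

lemma bil_sum: "bil V (\<lambda>i j. \<Sum>k\<in>K. a k i j) x z = (\<Sum>k\<in>K. bil V (a k) x z)"
proof -
  have "bil V (\<lambda>i j. \<Sum>k\<in>K. a k i j) x z = (\<Sum>i\<in>V. \<Sum>j\<in>V. \<Sum>k\<in>K. x i * a k i j * z j)"
    unfolding bil_def by (simp add: sum_distrib_left sum_distrib_right)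
  also have "\<dots> = (\<Sum>i\<in>V. \<Sum>k\<in>K. \<Sum>j\<in>V. x i * a k i j * z j)"
    by (intro sum.cong refl sum.swap)
  also have "\<dots> = (\<Sum>k\<in>K. bil V (a k) x z)"
    unfolding bil_def by (rule sum.swap)
  finally show ?thesis .
qed

lemma bil_axis:
  assumes "finite V" "i \<in> V"
  shows "bil V a (\<lambda>v. if v = i then c else 0) z = c * (\<Sum>j\<in>V. a i j * z j)"
proof -
  have "bil V a (\<lambda>v. if v = i then c else 0) z
        = (\<Sum>v\<in>V. if v = i then c * (\<Sum>j\<in>V. a i j * z j) else 0)"
    unfolding bil_def by (intro sum.cong refl) (auto simp: sum_distrib_left mult_ac)
  then show ?thesis using assms by simp
qed

lemma sum_mult_axis:
  fixes c :: real
  assumes "finite V" "i \<in> V"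
  shows "(\<Sum>j\<in>V. g j * (if j = i then c else 0)) = g i * c"
  using assms by (simp add: if_distrib[of "\<lambda>x. _ * x"] cong: if_cong)

lemma lorentz_perp:
  assumes "lorentz V a" "bil V a x x > 0" "bil V a x z = 0"
  shows "bil V a z z \<le> 0"
proof -
  have "bil V a x x * bil V a z z \<le> 0"
    using assms unfolding lorentz_def by (metis power_zero_numeral)
  then show ?thesis using assms(2) by (simp add: mult_le_0_iff)
qed

text \<open>A vector \<open>x\<close> of positive value lies off the hyperplane
  \<open>l = 0\<close>, so subtracting a multiple of \<open>x\<close> moves any \<open>z\<close>
  into it. Nonpositivity there, multiplied by \<open>bil V a x x\<close>, is the reversed
  Cauchy-Schwarz inequality up to a square.\<close>

lemma lorentzI_hyperplane:
  assumes sym: "\<forall>i j. a i j = a j i"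
    and lin: "\<And>z x t. l (\<lambda>i. z i - t * x i) = l z - t * l x"
    and neg: "\<And>z. l z = (0::real) \<Longrightarrow> bil V a z z \<le> 0"
  shows "lorentz V a"
  unfolding lorentz_def
proof (intro allI impI)
  fix x z assume pos: "bil V a x x > 0"
  have lx: "l x \<noteq> 0" using neg[of x] pos by auto
  define t where "t = l z / l x"
  have "l (\<lambda>i. z i - t * x i) = 0" unfolding lin using lx by (simp add: t_def)
  then have "bil V a z z - 2 * t * bil V a z x + t\<^sup>2 * bil V a x x \<le> 0"
    using neg bil_diff_square[OF sym] by metis
  then have "bil V a x x * (bil V a z z - 2 * t * bil V a z x + t\<^sup>2 * bil V a x x) \<le> 0"
    using pos by (simp add: mult_le_0_iff)
  moreover have "bil V a x x * (bil V a z z - 2 * t * bil V a z x + t\<^sup>2 * bil V a x x)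
     = bil V a x x * bil V a z z - (bil V a z x)\<^sup>2 + (bil V a z x - t * bil V a x x)\<^sup>2"
    by (simp add: power2_eq_square algebra_simps)
  ultimately show "bil V a x x * bil V a z z \<le> (bil V a x z)\<^sup>2"
    using bil_sym[OF sym, of V x z] by (smt (verit) zero_le_power2)
qed

text \<open>One link of the telescope in \<open>lorentz_chain\<close>. If \<open>t\<close> makes z -
  t d orthogonal to \<open>e\<close> (t = p / u) or to \<open>e'\<close> (t = q / v), the form is
  nonpositive on that vector; expanding with A(d, d) = u - v and completing a square gives the
  bound. Signs propagate because A(e, e) A(e', e') \<le> A(e, e')^2: if A(e, e) \<ge> A(e, e'), then
  A(e, e') \<ge> A(e', e'). Since x / 0 = 0, the bounds at a zero of \<open>u\<close> or
  \<open>v\<close> rely on \<open>p\<close> or \<open>q\<close> vanishing there too.\<close>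

lemma lorentz_step:
  fixes V a e e' z
  defines "d \<equiv> (\<lambda>i. e i - 1 * e' i)"
  defines "p \<equiv> bil V a e z" and "q \<equiv> bil V a e' z"
    and "u \<equiv> bil V a e d" and "v \<equiv> bil V a e' d"
  assumes sym: "\<forall>i j. a i j = a j i" and L: "lorentz V a"
    and pos: "bil V a e e > 0" "bil V a e' e' > 0" "bil V a e e' > 0"
  shows "u \<ge> 0 \<Longrightarrow> v \<ge> 0"
    and "u \<ge> 0 \<Longrightarrow> (u = 0 \<Longrightarrow> p = 0) \<Longrightarrow> v = 0 \<Longrightarrow> q = 0"
    and "u \<ge> 0 \<Longrightarrow> (u = 0 \<Longrightarrow> p = 0) \<Longrightarrow> bil V a z z \<le> p\<^sup>2 / u - q\<^sup>2 / v"
    and "u < 0 \<Longrightarrow> v < 0 \<or> p * v = q * u \<Longrightarrow> bil V a z z \<le> p\<^sup>2 / u - q\<^sup>2 / v"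
proof -
  have ee': "bil V a e' e = bil V a e e'" by (rule bil_sym[OF sym])
  have u_eq: "u = bil V a e e - bil V a e e'"
    unfolding u_def d_def bil_diff_right by simp
  have v_eq: "v = bil V a e e' - bil V a e' e'"
    unfolding v_def d_def bil_diff_right ee' by simp
  have lc: "bil V a e e * bil V a e' e' \<le> (bil V a e e')\<^sup>2"
    using L pos(1) unfolding lorentz_def by blast
  have zd: "bil V a z d = p - q"
    using bil_sym[OF sym, of V z d] unfolding p_def q_def d_def bil_diff_left by simp
  have dd: "bil V a d d = u - v"
    using bil_diff_left[of V a e 1 e' d] unfolding u_def v_def d_def by simp
  have sq: "bil V a (\<lambda>i. z i - t * d i) (\<lambda>i. z i - t * d i)
            = bil V a z z - 2 * t * (p - q) + t\<^sup>2 * (u - v)" for t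
    using bil_diff_square[OF sym] zd dd by simp
  have perp1: "bil V a z z \<le> 2 * t * (p - q) - t\<^sup>2 * (u - v)" if "p = t * u" for t
  proof -
    have "bil V a e (\<lambda>i. z i - t * d i) = 0"
      using that unfolding bil_diff_right p_def u_def by simp
    from lorentz_perp[OF L pos(1) this] show ?thesis unfolding sq by simp
  qed
  have perp2: "bil V a z z \<le> 2 * t * (p - q) - t\<^sup>2 * (u - v)" if "q = t * v" for t
  proof -
    have "bil V a e' (\<lambda>i. z i - t * d i) = 0"
      using that unfolding bil_diff_right q_def v_def by simp
    from lorentz_perp[OF L pos(2) this] show ?thesis unfolding sq by simp
  qed
  have lc': "bil V a e e * bil V a e' e' \<le> bil V a e e' * bil V a e e'"
    using lc by (simp add: power2_eq_square)
  show vge: "v \<ge> 0" if "u \<ge> 0"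
  proof (rule ccontr)
    assume "\<not> v \<ge> 0"
    then have "bil V a e e' < bil V a e' e'" using v_eq by simp
    then have "bil V a e e' * bil V a e e' < bil V a e e' * bil V a e' e'"
      using pos by (intro mult_strict_left_mono)
    also have "\<dots> \<le> bil V a e e * bil V a e' e'"
      using that u_eq pos by (intro mult_right_mono) auto
    finally show False using lc' by simp
  qed
  have v0u0: "u = 0" if "u \<ge> 0" "v = 0"
  proof -
    have "bil V a e' e' = bil V a e e'" using that v_eq by simp
    with lc' have "bil V a e e \<le> bil V a e e'"
      using pos by (metis mult_le_cancel_right_pos)
    then show ?thesis using that u_eq by simp
  qed
  show q0: "q = 0" if "u \<ge> 0" "u = 0 \<Longrightarrow> p = 0" "v = 0"
  proof (rule ccontr)
    assume "q \<noteq> 0"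
    have "u = 0" "p = 0" using v0u0 that by auto
    \<comment> \<open>With p = u = 0 every \<open>t\<close> is admissible in \<open>perp1\<close>,
      and a bound linear in \<open>t\<close> can hold for all \<open>t\<close> only if its slope
      vanishes.\<close>
    then have *: "bil V a z z \<le> - 2 * t * q" for t using perp1[of t] that by simp
    from *[of "(1 - bil V a z z) / (2 * q)"] \<open>q \<noteq> 0\<close> show False by simp
  qed
  show "bil V a z z \<le> p\<^sup>2 / u - q\<^sup>2 / v" if u: "u \<ge> 0" "u = 0 \<Longrightarrow> p = 0"
  proof (cases "v = 0")
    case True
    then have "u = 0" "p = 0" using v0u0 u by auto
    then show ?thesis using True perp1[of 0] by simp
  next
    case False
    then have v: "v > 0" using vge u by simp
    define t where "t = q / v"
    have q: "q = t * v" using False by (simp add: t_def)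
    have "bil V a z z \<le> 2 * t * (p - q) - t\<^sup>2 * (u - v)" using perp2[OF q] .
    also have "\<dots> = 2 * t * p - t\<^sup>2 * u - q\<^sup>2 / v"
      using False by (simp add: q power2_eq_square algebra_simps)
    also have "2 * t * p - t\<^sup>2 * u \<le> p\<^sup>2 / u"
    proof (cases "u = 0")
      case True then show ?thesis using u by simp
    next
      case False
      then have "u > 0" using u by simp
      moreover have "(2 * t * p - t\<^sup>2 * u) * u = p\<^sup>2 - (p - t * u)\<^sup>2"
        by (simp add: power2_eq_square algebra_simps)
      ultimately show ?thesis by (simp add: le_divide_eq)
    qed
    finally show ?thesis by simp
  qed
  show "bil V a z z \<le> p\<^sup>2 / u - q\<^sup>2 / v" if u: "u < 0" and v: "v < 0 \<or> p * v = q * u"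
  proof -
    define t where "t = p / u"
    have p: "p = t * u" using u by (simp add: t_def)
    have "bil V a z z \<le> 2 * t * (p - q) - t\<^sup>2 * (u - v)" using perp1[OF p] .
    also have "\<dots> = p\<^sup>2 / u - (2 * t * q - t\<^sup>2 * v)"
      using u by (simp add: p power2_eq_square algebra_simps)
    moreover have "q\<^sup>2 / v \<le> 2 * t * q - t\<^sup>2 * v"
    proof (cases "v < 0")
      case True
      have "q\<^sup>2 = (2 * t * q - t\<^sup>2 * v) * v + (q - t * v)\<^sup>2"
        by (simp add: power2_eq_square algebra_simps)
      then have "(2 * t * q - t\<^sup>2 * v) * v \<le> q\<^sup>2" by (smt (verit) zero_le_power2)
      then show ?thesis using True by (simp add: neg_divide_le_eq)
    next
      case False
      then have "u * (t * v - q) = 0" using v p by (auto simp: algebra_simps)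
      then have q: "q = t * v" using u by simp
      show ?thesis by (cases "v = 0") (simp_all add: q power2_eq_square)
    qed
    ultimately show ?thesis by simp
  qed
qed

text \<open>With \<open>d = e - e'\<close>, \<open>p\<^sub>k = A\<^sub>k(e, z)\<close> and \<open>u\<^sub>k = A\<^sub>k(e, d)\<close>, the bounds
  \<open>A\<^sub>k(z, z) \<le> p\<^sub>k\<^sup>2 / u\<^sub>k - p\<^sub>k\<^sub>+\<^sub>1\<^sup>2 / u\<^sub>k\<^sub>+\<^sub>1\<close> telescope. By log-concavity the
  sequence \<open>u\<close> changes sign at most once, from negative to nonnegative, and a single linear
  condition on \<open>z\<close> handles the sign change. Where \<open>u\<^sub>k = 0\<close> also \<open>p\<^sub>k = 0\<close>, so that the
  quotient is 0.\<close>
lemma lorentz_chain: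
  fixes a :: "nat \<Rightarrow> nat \<Rightarrow> nat \<Rightarrow> real"
  assumes sym: "\<And>k. k \<le> R \<Longrightarrow> \<forall>i j. a k i j = a k j i"
    and L: "\<And>k. k \<le> R \<Longrightarrow> lorentz V (a k)"
    and pos: "\<And>k. k \<le> R \<Longrightarrow> bil V (a k) e e > 0"
      "\<And>k. k \<le> R \<Longrightarrow> bil V (a k) e' e' > 0" "\<And>k. k \<le> R \<Longrightarrow> bil V (a k) e e' > 0"
    and link: "\<And>k z. k < R \<Longrightarrow> bil V (a k) e' z = bil V (a (Suc k)) e z"
  shows "lorentz V (\<lambda>i j. \<Sum>k\<le>R. a k i j)"
proof -
  define d where "d = (\<lambda>i. e i - 1 * e' i)"
  \<comment> \<open>By \<open>link\<close> the row of \<open>e'\<close> in form k is the row of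
    \<open>e\<close> in form k + 1, so the rows make up a single sequence of R + 2 functionals, the
    last one taken from \<open>e'\<close>.\<close>
  define P where "P k z = (if k \<le> R then bil V (a k) e z else bil V (a R) e' z)" for k z
  define U where "U k = P k d" for k
  define Q where "Q z k = (P k z)\<^sup>2 / U k" for z k
  have P1: "P k z = bil V (a k) e z" if "k \<le> R" for k z
    using that by (simp add: P_def)
  have P2: "P (Suc k) z = bil V (a k) e' z" if "k \<le> R" for k z
    using that link[of k z] by (cases "k = R") (auto simp: P_def)
  have Plin: "P k (\<lambda>i. z i - t * x i) = P k z - t * P k x" for k z t x
    by (simp add: P_def bil_diff_right)
  note step = lorentz_step[OF sym L pos, folded d_def]
  have up1: "U (Suc k) \<ge> 0" if "k \<le> R" "U k \<ge> 0" for k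
    using step(1)[OF that(1) that(1) that(1) that(1) that(1)] that P1 P2 by (simp add: U_def)
  have up2: "P (Suc k) z = 0"
    if "k \<le> R" "U k \<ge> 0" "U k = 0 \<Longrightarrow> P k z = 0" "U (Suc k) = 0" for k z
    using step(2)[OF that(1) that(1) that(1) that(1) that(1), of z] that P1 P2
    by (simp add: U_def)
  have up3: "bil V (a k) z z \<le> Q z k - Q z (Suc k)"
    if "k \<le> R" "U k \<ge> 0" "U k = 0 \<Longrightarrow> P k z = 0" for k z
    using step(3)[OF that(1) that(1) that(1) that(1) that(1), of z] that P1 P2
    by (simp add: U_def Q_def)
  have down: "bil V (a k) z z \<le> Q z k - Q z (Suc k)"
    if "k \<le> R" "U k < 0" "U (Suc k) < 0 \<or> P k z * U (Suc k) = P (Suc k) z * U k" for k z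
    using step(4)[OF that(1) that(1) that(1) that(1) that(1), of z] that P1 P2
    by (simp add: U_def Q_def)
  have upward: "U k \<ge> 0 \<and> (U k = 0 \<longrightarrow> P k z = 0)"
    if "k0 \<le> k" "k \<le> Suc R" "U k0 \<ge> 0" "U k0 = 0 \<Longrightarrow> P k0 z = 0" for k0 k z
    using that(1,2)
  proof (induction k rule: dec_induct)
    case base then show ?case using that by simp
  next
    case (step k)
    then have "k \<le> R" "U k \<ge> 0" "U k = 0 \<longrightarrow> P k z = 0" by auto
    then show ?case using up1[of k] up2[of k z] by auto
  qed
  have symS: "\<forall>i j. (\<Sum>k\<le>R. a k i j) = (\<Sum>k\<le>R. a k j i)"
    using sym by (auto intro!: sum.cong)
  have total: "bil V (\<lambda>i j. \<Sum>k\<le>R. a k i j) z z \<le> 0"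
    if "\<And>k. k \<le> R \<Longrightarrow> bil V (a k) z z \<le> Q z k - Q z (Suc k)" "Q z 0 \<le> 0" "Q z (Suc R) \<ge> 0" for z
  proof -
    have "bil V (\<lambda>i j. \<Sum>k\<le>R. a k i j) z z \<le> (\<Sum>k\<le>R. Q z k - Q z (Suc k))"
      unfolding bil_sum using that(1) by (intro sum_mono) simp
    also have "\<dots> = Q z 0 - Q z (Suc R)" by (rule sum_telescope)
    finally show ?thesis using that by simp
  qed
  show ?thesis
  proof (cases "\<exists>k\<le>Suc R. U k \<ge> 0")
    case False
    then have neg: "U k < 0" if "k \<le> Suc R" for k using that by (meson not_le)
    \<comment> \<open>All u_k are negative, so the first quotient is \<le> 0 already; the hyperplane
      makes the last one vanish.\<close>
    show ?thesis
    proof (rule lorentzI_hyperplane[where l = "P (Suc R)", OF symS Plin])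
      fix z assume "P (Suc R) z = 0"
      then show "bil V (\<lambda>i j. \<Sum>k\<le>R. a k i j) z z \<le> 0"
        using neg[of 0] by (intro total down neg disjI1) (simp_all add: Q_def divide_le_0_iff)
    qed
  next
    case True
    define m where "m = (LEAST k. k \<le> Suc R \<and> U k \<ge> 0)"
    have m: "m \<le> Suc R" "U m \<ge> 0" using LeastI_ex[OF True] by (auto simp: m_def)
    have neg: "U k < 0" if "k < m" for k
      using not_less_Least[of k "\<lambda>k. k \<le> Suc R \<and> U k \<ge> 0"] that m unfolding m_def[symmetric]
      by auto
    show ?thesis
    proof (cases m)
      case 0
      show ?thesis
      proof (rule lorentzI_hyperplane[where l = "P 0", OF symS Plin])
        fix z assume z: "P 0 z = 0"
        have *: "U k \<ge> 0 \<and> (U k = 0 \<longrightarrow> P k z = 0)" if "k \<le> Suc R" for k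
          using upward[of 0 k z] that m z 0 by simp
        then show "bil V (\<lambda>i j. \<Sum>k\<le>R. a k i j) z z \<le> 0"
          using z by (intro total up3) (auto simp: Q_def)
      qed
    next
      case (Suc m')
      \<comment> \<open>At the sign change u_{m'} < 0 \<le> u_m this condition is the second
        alternative in \<open>down\<close>. If u_m = 0 it also gives p_m = 0, from which
        \<open>upward\<close> can start.\<close>
      define l where "l z = P m' z * U m - P m z * U m'" for z
      show ?thesis
      proof (rule lorentzI_hyperplane[where l = l, OF symS])
        show "l (\<lambda>i. z i - t * x i) = l z - t * l x" for z x t
          by (simp add: l_def Plin algebra_simps)
        fix z assume "l z = 0"
        then have z: "P m' z * U m = P m z * U m'" by (simp add: l_def)
        have "P m z = 0" if "U m = 0" using z neg[of m'] that Suc by auto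
        then have *: "U k \<ge> 0 \<and> (U k = 0 \<longrightarrow> P k z = 0)" if "m \<le> k" "k \<le> Suc R" for k
          using upward[of m k z] that m by blast
        have "bil V (a k) z z \<le> Q z k - Q z (Suc k)" if "k \<le> R" for k
        proof (cases "m \<le> k")
          case True then show ?thesis using * that by (intro up3) auto
        next
          case False
          then have "k = m' \<or> Suc k < m" using Suc by auto
          then show ?thesis using False neg z Suc that by (intro down) auto
        qed
        moreover have "Q z 0 \<le> 0" "Q z (Suc R) \<ge> 0"
          using neg[of 0] Suc *[of "Suc R"] m by (auto simp: Q_def divide_le_0_iff)
        ultimately show "bil V (\<lambda>i j. \<Sum>k\<le>R. a k i j) z z \<le> 0" by (rule total)
      qed
    qed
  qed
qed

section \<open>Log-concavity of weighted flow counts on a directed multigraph\<close>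

text \<open>The cap \<open>R\<close> keeps all sums finite. A large enough cap loses no flow of the
  kind counted later, by \<open>flows_subset_bnd\<close>.\<close>

definition bnd :: "'e set \<Rightarrow> nat \<Rightarrow> ('e \<Rightarrow> nat) set" where
  "bnd E R = {f. \<forall>e. if e \<in> E then f e \<le> R else f e = 0}"

lemma bnd_empty [simp]: "bnd {} R = {\<lambda>_. 0}"
  by (auto simp: bnd_def)

lemma bnd_eq_0: "f \<in> bnd E R \<Longrightarrow> e \<notin> E \<Longrightarrow> f e = 0"
  unfolding bnd_def by (drule CollectD, drule spec[of _ e]) simp

lemma bnd_insert:
  assumes "e \<notin> E"
  shows "bij_betw (\<lambda>(k, f). f(e := k)) ({..R} \<times> bnd E R) (bnd (insert e E) R)"
proof (rule bij_betw_byWitness[where f' = "\<lambda>f. (f e, f(e := 0))"])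
  show "\<forall>a\<in>{..R} \<times> bnd E R. (\<lambda>f. (f e, f(e := 0))) ((\<lambda>(k, f). f(e := k)) a) = a"
    using assms by (auto simp: bnd_def fun_eq_iff)
  show "\<forall>a'\<in>bnd (insert e E) R. (\<lambda>(k, f). f(e := k)) (a' e, a'(e := 0)) = a'"
    by auto
  show "(\<lambda>(k, f). f(e := k)) ` ({..R} \<times> bnd E R) \<subseteq> bnd (insert e E) R"
    by (auto simp: bnd_def)
  show "(\<lambda>f. (f e, f(e := 0))) ` bnd (insert e E) R \<subseteq> {..R} \<times> bnd E R"
    using assms by (auto simp: bnd_def split: if_splits)
qed

lemma finite_bnd: "finite E \<Longrightarrow> finite (bnd E R)"
proof (induction E rule: finite_induct)
  case (insert e E)
  then show ?case using bij_betw_finite[OF bnd_insert[of e E R]] by simp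
qed simp

lemma sum_bnd_insert:
  assumes "e \<notin> E"
  shows "(\<Sum>f\<in>bnd (insert e E) R. h f) = (\<Sum>k\<le>R. \<Sum>f\<in>bnd E R. h (f(e := k)))"
  unfolding sum.cartesian_product sum.reindex_bij_betw[OF bnd_insert[OF assms], symmetric]
  by (simp add: case_prod_unfold)

lemma sum_bnd_prod_power:
  fixes w :: "'e \<Rightarrow> 'a::comm_semiring_1"
  assumes "finite E"
  shows "(\<Sum>f\<in>bnd E R. \<Prod>e\<in>E. w e ^ f e) = (\<Prod>e\<in>E. \<Sum>k\<le>R. w e ^ k)"
  using assms
proof (induction E rule: finite_induct)
  case (insert e E)
  have "(\<Prod>e'\<in>E. w e' ^ (f(e := k)) e') = (\<Prod>e'\<in>E. w e' ^ f e')" for f k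
    using insert by (intro prod.cong) auto
  then show ?case
    using insert by (simp add: sum_bnd_insert sum_distrib_left[symmetric] sum_distrib_right)
qed simp

definition net :: "('e \<Rightarrow> nat) \<Rightarrow> ('e \<Rightarrow> nat) \<Rightarrow> 'e set \<Rightarrow> ('e \<Rightarrow> nat) \<Rightarrow> nat \<Rightarrow> int" where
  "net src tgt E f v = (\<Sum>e\<in>E. int (f e) * (of_bool (src e = v) - of_bool (tgt e = v)))"

definition unitv :: "nat \<Rightarrow> nat \<Rightarrow> int" where
  "unitv i v = of_bool (i = v)"

text \<open>The number of weighted bounded flows with net flow \<open>\<gamma>\<close>, with the condition on the net flow
  smoothed to a Gaussian weight: this makes all entries positive, so that no support conditions
  are needed. The limit \<open>b \<longrightarrow> \<infinity>\<close> restores the condition.\<close>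
definition gauss_flows where
  "gauss_flows V src tgt w R b E \<gamma> = (\<Sum>f\<in>bnd E R. (\<Prod>e\<in>E. w e ^ f e) *
     exp (- b * (\<Sum>v\<in>V. (real_of_int (\<gamma> v - net src tgt E f v))\<^sup>2)))"

lemma gauss_flows_pos:
  assumes "finite E" "\<And>e. e \<in> E \<Longrightarrow> w e > 0"
  shows "gauss_flows V src tgt w R b E \<gamma> > 0"
proof -
  have "(\<lambda>_. 0) \<in> bnd E R" by (simp add: bnd_def)
  then show ?thesis unfolding gauss_flows_def
    using assms by (intro sum_pos finite_bnd mult_pos_pos prod_pos) auto
qed

lemma gauss_flows_insert:
  assumes "finite E" "e \<notin> E"
  shows "gauss_flows V src tgt w R b (insert e E) \<gamma> = (\<Sum>k\<le>R. w e ^ k *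
     gauss_flows V src tgt w R b E (\<lambda>v. \<gamma> v - int k * (unitv (src e) v - unitv (tgt e) v)))"
proof -
  have "(\<Prod>e'\<in>E. w e' ^ (f(e := k)) e') = (\<Prod>e'\<in>E. w e' ^ f e')" for f k
    using assms by (intro prod.cong) auto
  then have 1: "(\<Prod>e'\<in>insert e E. w e' ^ (f(e := k)) e') = w e ^ k * (\<Prod>e'\<in>E. w e' ^ f e')" for f k
    using assms by simp
  have 2: "net src tgt (insert e E) (f(e := k)) v
     = int k * (unitv (src e) v - unitv (tgt e) v) + net src tgt E f v" for f k v
  proof -
    have "(\<Sum>e'\<in>E. int ((f(e := k)) e') * (of_bool (src e' = v) - of_bool (tgt e' = v)))
        = (\<Sum>e'\<in>E. int (f e') * (of_bool (src e' = v) - of_bool (tgt e' = v)))"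
      using assms by (intro sum.cong) auto
    then show ?thesis using assms by (simp add: net_def unitv_def)
  qed
  have "\<gamma> v - net src tgt (insert e E) (f(e := k)) v
      = \<gamma> v - int k * (unitv (src e) v - unitv (tgt e) v) - net src tgt E f v" for f k v
    using 2[of f k v] by simp
  note 3 = this
  show ?thesis
    unfolding gauss_flows_def sum_bnd_insert[OF assms(2)] 1 3
    by (simp only: sum_distrib_left mult.assoc)
qed

text \<open>The case without edges. The exponent is affine in \<mu>_i and \<mu>_j apart from an
  extra 2 on the diagonal, so the matrix is a positive rank-one matrix minus a nonnegative diagonal
  one, as \<theta> \<le> 1. It is therefore nonpositive on the kernel of the rank-one part.\<close>

lemma lorentz_gauss:
  assumes "finite V" "b \<ge> 0"
  shows "lorentz V (\<lambda>i j. exp (- b * (\<Sum>v\<in>V. (real_of_int (\<mu> v + unitv i v + unitv j v))\<^sup>2)))"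
    (is "lorentz V ?a")
proof -
  define K where "K = exp (- b * ((\<Sum>v\<in>V. (real_of_int (\<mu> v))\<^sup>2) + 2))"
  define m where "m i = exp (- b * (2 * real_of_int (\<mu> i)))" for i
  define \<theta> where "\<theta> = exp (- b * 2)"
  define a where "a i j = K * m i * m j * (1 - (1 - \<theta>) * of_bool (i = j))" for i j
  have a: "?a i j = a i j" if "i \<in> V" "j \<in> V" for i j
  proof -
    have "(\<Sum>v\<in>V. (real_of_int (\<mu> v + unitv i v + unitv j v))\<^sup>2)
       = (\<Sum>v\<in>V. (real_of_int (\<mu> v))\<^sup>2 + (if v = i then 2 * real_of_int (\<mu> i) + 1 else 0)
           + (if v = j then 2 * real_of_int (\<mu> j) + 1 else 0)
           + (if v = i then 2 * of_bool (i = j) else 0))"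
      by (intro sum.cong refl) (auto simp: unitv_def power2_eq_square algebra_simps)
    also have "\<dots> = (\<Sum>v\<in>V. (real_of_int (\<mu> v))\<^sup>2) + 2 + 2 * real_of_int (\<mu> i)
        + 2 * real_of_int (\<mu> j) + 2 * of_bool (i = j)"
      using that assms by (simp add: sum.distrib)
    finally show ?thesis
      by (auto simp: a_def K_def m_def \<theta>_def exp_add[symmetric] algebra_simps)
  qed
  have bil_eq: "bil V ?a x z = bil V a x z" for x z
    unfolding bil_def by (intro sum.cong refl) (simp only: a)
  have "lorentz V a"
  proof (rule lorentzI_hyperplane[where l = "\<lambda>z. \<Sum>i\<in>V. m i * z i"])
    show "\<forall>i j. a i j = a j i" by (auto simp: a_def)
    show "(\<Sum>i\<in>V. m i * (z i - t * x i)) = (\<Sum>i\<in>V. m i * z i) - t * (\<Sum>i\<in>V. m i * x i)" for z x t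
      by (simp add: algebra_simps sum_subtractf sum_distrib_left)
    fix z assume z: "(\<Sum>i\<in>V. m i * z i) = 0"
    have "bil V a z z = (\<Sum>i\<in>V. \<Sum>j\<in>V. K * ((m i * z i) * (m j * z j))
        - (if j = i then K * (1 - \<theta>) * (m i * z i)\<^sup>2 else 0))"
      unfolding bil_def
      by (intro sum.cong refl) (auto simp: a_def power2_eq_square algebra_simps)
    also have "\<dots> = K * ((\<Sum>i\<in>V. m i * z i) * (\<Sum>i\<in>V. m i * z i))
        - K * (1 - \<theta>) * (\<Sum>i\<in>V. (m i * z i)\<^sup>2)"
      using assms(1) unfolding sum_product by (simp add: sum_subtractf sum_distrib_left)
    also have "\<dots> \<le> 0"
      using assms(2) z by (simp add: K_def \<theta>_def sum_nonneg)
    finally show "bil V a z z \<le> 0" .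
  qed
  then show ?thesis unfolding lorentz_def bil_eq .
qed

lemma lorentz_gauss_flows:
  assumes "finite E" "finite V" "b \<ge> 0"
    and "\<And>e. e \<in> E \<Longrightarrow> src e \<in> V \<and> tgt e \<in> V \<and> w e > 0"
  shows "lorentz V (\<lambda>i j. gauss_flows V src tgt w R b E (\<lambda>v. \<mu> v + unitv i v + unitv j v))"
  using assms(1,4)
proof (induction E arbitrary: \<mu> rule: finite_induct)
  case empty
  then show ?case
    using lorentz_gauss[OF assms(2,3)] by (simp add: gauss_flows_def net_def)
next
  case (insert e E)
  define x y where "x = src e" and "y = tgt e"
  define F where "F = gauss_flows V src tgt w R b E"
  \<comment> \<open>Consecutive shifts meet: M_k + e_y = M_{k+1} + e_x. The factor
    \<open>w e\<close> in \<open>ey\<close> makes up for the change from w^k to w^(k+1), so the axis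
    vectors \<open>ex\<close> and \<open>ey\<close> satisfy the linking condition of
    \<open>lorentz_chain\<close>.\<close>
  define M where "M k v = \<mu> v - int k * (unitv x v - unitv y v)" for k v
  define a where "a k i j = w e ^ k * F (\<lambda>v. M k v + unitv i v + unitv j v)" for k i j
  define ex where "ex = (\<lambda>v. if v = x then 1 else 0::real)"
  define ey where "ey = (\<lambda>v. if v = y then w e else 0)"
  have xy: "x \<in> V" "y \<in> V" and w: "w e > 0"
    using insert.prems by (auto simp: x_def y_def)
  have Fpos: "F \<gamma> > 0" for \<gamma>
    unfolding F_def using insert by (intro gauss_flows_pos) auto
  have apos: "a k i j > 0" for k i j
    using w Fpos by (simp add: a_def)
  have bx: "bil V (a k) ex z = (\<Sum>j\<in>V. a k x j * z j)" for k z
    unfolding ex_def using assms(2) xy by (simp add: bil_axis)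
  have bey: "bil V (a k) ey z = w e * (\<Sum>j\<in>V. a k y j * z j)" for k z
    unfolding ey_def using assms(2) xy by (simp add: bil_axis)
  note sum_axis = sum_mult_axis[OF assms(2)]
  have "lorentz V (\<lambda>i j. \<Sum>k\<le>R. a k i j)"
  proof (rule lorentz_chain)
    show "\<forall>i j. a k i j = a k j i" for k
      by (simp add: a_def add_ac)
    show "lorentz V (a k)" for k
    proof -
      have "lorentz V (\<lambda>i j. F (\<lambda>v. M k v + unitv i v + unitv j v))"
        unfolding F_def by (rule insert.IH) (use insert.prems in auto)
      moreover have "bil V (a k) p q = w e ^ k * bil V (\<lambda>i j. F (\<lambda>v. M k v + unitv i v + unitv j v)) p q" for p q
        unfolding bil_def by (simp add: a_def sum_distrib_left mult_ac)
      ultimately show ?thesis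
        using w unfolding lorentz_def
        by (simp add: zero_less_mult_iff power2_eq_square mult_ac mult_left_mono)
    qed
    show "bil V (a k) ex ex > 0" for k
      unfolding bx unfolding ex_def sum_axis[OF xy(1)] using apos by simp
    show "bil V (a k) ey ey > 0" for k
      unfolding bey unfolding ey_def sum_axis[OF xy(2)] using apos w by simp
    show "bil V (a k) ex ey > 0" for k
      unfolding bx unfolding ey_def sum_axis[OF xy(2)] using apos w by simp
    show "bil V (a k) ey z = bil V (a (Suc k)) ex z" for k z
    proof -
      have "M k v + unitv y v = M (Suc k) v + unitv x v" for v
        by (simp add: M_def algebra_simps)
      then have "w e * a k y j = a (Suc k) x j" for j
        by (simp add: a_def)
      then show ?thesis unfolding bx bey by (simp add: sum_distrib_left mult.assoc[symmetric])
    qed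
  qed
  moreover have "gauss_flows V src tgt w R b (insert e E) (\<lambda>v. \<mu> v + unitv i v + unitv j v)
      = (\<Sum>k\<le>R. a k i j)" for i j
    unfolding gauss_flows_insert[OF insert.hyps] a_def F_def M_def x_def y_def
    by (simp add: algebra_simps)
  ultimately show ?case by simp
qed

definition weighted_flows where
  "weighted_flows V src tgt w R E \<gamma> =
     (\<Sum>f\<in>{f \<in> bnd E R. \<forall>v\<in>V. net src tgt E f v = \<gamma> v}. \<Prod>e\<in>E. (w e :: real) ^ f e)"

lemma gauss_flows_tendsto:
  assumes "finite E" "finite V"
  shows "(\<lambda>b. gauss_flows V src tgt w R (real b) E \<gamma>) \<longlonglongrightarrow> weighted_flows V src tgt w R E \<gamma>"
proof -
  have lim: "(\<lambda>b. exp (- real b * (\<Sum>v\<in>V. (real_of_int (\<gamma> v - g v))\<^sup>2)))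
      \<longlonglongrightarrow> (if \<forall>v\<in>V. g v = \<gamma> v then 1 else 0)" for g
  proof (cases "\<forall>v\<in>V. g v = \<gamma> v")
    case True
    then have "(\<Sum>v\<in>V. (real_of_int (\<gamma> v - g v))\<^sup>2) = 0" by simp
    then show ?thesis using True by simp
  next
    case False
    define s where "s = (\<Sum>v\<in>V. (real_of_int (\<gamma> v - g v))\<^sup>2)"
    have "s \<noteq> 0" unfolding s_def using False assms(2) by (force simp: sum_nonneg_eq_0_iff)
    moreover have "s \<ge> 0" unfolding s_def by (simp add: sum_nonneg)
    ultimately have "s > 0" by simp
    have "(\<lambda>b. exp (- s) ^ b) \<longlonglongrightarrow> 0"
      using \<open>s > 0\<close> by (intro LIMSEQ_power_zero) simp
    then have "(\<lambda>b. exp (- real b * s)) \<longlonglongrightarrow> 0"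
      by (simp add: exp_of_nat_mult[symmetric])
    then show ?thesis using False by (simp add: s_def)
  qed
  have "(\<lambda>b. gauss_flows V src tgt w R (real b) E \<gamma>) \<longlonglongrightarrow>
     (\<Sum>f\<in>bnd E R. (\<Prod>e\<in>E. w e ^ f e) * (if \<forall>v\<in>V. net src tgt E f v = \<gamma> v then 1 else 0))"
    unfolding gauss_flows_def by (intro tendsto_sum tendsto_mult tendsto_const lim)
  also have "(\<Sum>f\<in>bnd E R. (\<Prod>e\<in>E. w e ^ f e) * (if \<forall>v\<in>V. net src tgt E f v = \<gamma> v then 1 else 0))
     = weighted_flows V src tgt w R E \<gamma>"
    unfolding weighted_flows_def using finite_bnd[OF assms(1)]
    by (subst sum.inter_filter) (auto intro!: sum.cong)
  finally show ?thesis .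
qed

text \<open>With base point \<mu> = \<gamma> - e_i - e_j, the matrix entries (i, i), (j, j) and (i,
  j) belong to \<gamma> + (e_i - e_j), \<gamma> - (e_i - e_j) and \<gamma>. The reversed
  Cauchy-Schwarz inequality for the two axis vectors is the claim for the Gaussian version, and it
  passes to the limit.\<close>

lemma weighted_flows_log_concave:
  fixes R :: nat
  assumes "finite E" "finite V" "i \<in> V" "j \<in> V"
    and E: "\<And>e. e \<in> E \<Longrightarrow> src e \<in> V \<and> tgt e \<in> V \<and> w e > 0"
  defines "W \<equiv> weighted_flows V src tgt w R E"
  shows "W (\<lambda>v. \<gamma> v + (unitv i v - unitv j v)) * W (\<lambda>v. \<gamma> v - (unitv i v - unitv j v)) \<le> (W \<gamma>)\<^sup>2"
proof -
  define \<mu> where "\<mu> v = \<gamma> v - unitv i v - unitv j v" for v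
  define A where "A b = gauss_flows V src tgt w R (real b) E" for b :: nat
  have *: "A b (\<lambda>v. \<gamma> v + (unitv i v - unitv j v)) * A b (\<lambda>v. \<gamma> v - (unitv i v - unitv j v)) \<le> (A b \<gamma>)\<^sup>2" for b
  proof -
    define a where "a p q = A b (\<lambda>v. \<mu> v + unitv p v + unitv q v)" for p q
    define ax where "ax p = (\<lambda>v. if v = p then 1 else 0::real)" for p :: nat
    have L: "lorentz V a"
      unfolding a_def A_def using assms by (intro lorentz_gauss_flows) auto
    have bax: "bil V a (ax p) (ax q) = a p q" if "p \<in> V" "q \<in> V" for p q
      unfolding ax_def using assms(2) that by (simp add: bil_axis sum_mult_axis)
    have "a i i > 0" unfolding a_def A_def using assms(1) E by (intro gauss_flows_pos) auto
    then have "a i i * a j j \<le> (a i j)\<^sup>2"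
      using L bax assms(3,4) unfolding lorentz_def by metis
    then show ?thesis by (simp add: a_def \<mu>_def algebra_simps)
  qed
  have lim: "(\<lambda>b. A b \<delta>) \<longlonglongrightarrow> W \<delta>" for \<delta>
    unfolding A_def W_def using assms(1,2) by (rule gauss_flows_tendsto)
  show ?thesis
    by (rule LIMSEQ_le[OF tendsto_mult[OF lim lim] tendsto_power[OF lim]]) (use * in blast)
qed

section \<open>Flows on the complete graph, one source vertex at a time\<close>

definition edges :: "nat \<Rightarrow> nat \<Rightarrow> (nat \<times> nat) set" where
  "edges n j = (SIGMA i:{..<j}. {i<..n})"

text \<open>Flows on the edges leaving one of the vertices below \<open>j\<close>; only there is the net flow
  prescribed.\<close>
definition flows :: "nat \<Rightarrow> nat \<Rightarrow> (nat \<Rightarrow> int) \<Rightarrow> (nat \<times> nat \<Rightarrow> nat) set" where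
  "flows n j N = {f. (\<forall>e. e \<notin> edges n j \<longrightarrow> f e = 0) \<and>
     (\<forall>i<j. (\<Sum>l\<in>{i<..n}. int (f (i, l))) - (\<Sum>k<i. int (f (k, i))) = N i)}"

lemma edges_iff: "(i, l) \<in> edges n j \<longleftrightarrow> i < j \<and> i < l \<and> l \<le> n"
  by (auto simp: edges_def)

lemma finite_edges [simp]: "finite (edges n j)"
  by (simp add: edges_def)

lemma edges_Suc: "edges n (Suc j) = edges n j \<union> Pair j ` {j<..n}"
  by (auto simp: edges_iff less_Suc_eq)

lemma edges_disjoint: "edges n j \<inter> Pair j ` {j<..n} = {}"
  by (auto simp: edges_iff)

text \<open>Edges inside {0, ..., j-1} cancel when the net flows are added; what remains crosses the
  cut between the vertices below \<open>j\<close> and the others.\<close>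

lemma sum_net_eq_cut:
  fixes f :: "nat \<times> nat \<Rightarrow> 'a::comm_ring_1"
  assumes "\<And>i. i < j \<Longrightarrow> (\<Sum>l\<in>{i<..n}. f (i, l)) - (\<Sum>k<i. f (k, i)) = N i" "j \<le> n"
  shows "(\<Sum>i<j. N i) = (\<Sum>i<j. \<Sum>l\<in>{j..n}. f (i, l))"
  using assms
proof (induction j)
  case (Suc j)
  have I: "{j..n} = insert j {Suc j..n}" "{j<..n} = {Suc j..n}" using Suc.prems by auto
  have "(\<Sum>i<Suc j. N i) = (\<Sum>i<j. \<Sum>l\<in>{j..n}. f (i, l)) + N j"
    using Suc by simp
  also have "(\<Sum>i<j. \<Sum>l\<in>{j..n}. f (i, l)) = (\<Sum>i<j. f (i, j)) + (\<Sum>i<j. \<Sum>l\<in>{Suc j..n}. f (i, l))"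
    unfolding I by (simp add: sum.distrib)
  also have "N j = (\<Sum>l\<in>{Suc j..n}. f (j, l)) - (\<Sum>k<j. f (k, j))"
    using Suc.prems(1)[of j] I by simp
  finally show ?case by simp
qed simp

lemma flows_cut:
  assumes "f \<in> flows n j N" "j' \<le> j" "j \<le> n"
  shows "(\<Sum>i<j'. N i) = (\<Sum>i<j'. \<Sum>l\<in>{j'..n}. int (f (i, l)))"
  using sum_net_eq_cut[where j = j' and n = n and f = "\<lambda>e. int (f e)" and N = N] assms by (auto simp: flows_def)

text \<open>The edge (i, l) crosses the cut just after \<open>i\<close>, whose total flow is s_i.
  The sum of all these values serves as a common cap.\<close>

lemma flows_subset_bnd:
  assumes "j \<le> n" "(\<Sum>i<j. nat (\<Sum>i'<Suc i. N i')) \<le> R"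
  shows "flows n j N \<subseteq> bnd (edges n j) R"
proof
  fix f assume f: "f \<in> flows n j N"
  have "f (i, l) \<le> R" if "(i, l) \<in> edges n j" for i l
  proof -
    have il: "i < j" "i < l" "l \<le> n" using that by (auto simp: edges_iff)
    have "int (f (i, l)) \<le> (\<Sum>l\<in>{Suc i..n}. int (f (i, l)))"
      using il by (intro member_le_sum) auto
    also have "\<dots> \<le> (\<Sum>i'<Suc i. \<Sum>l\<in>{Suc i..n}. int (f (i', l)))"
      by (rule member_le_sum[where f = "\<lambda>i'. \<Sum>l\<in>{Suc i..n}. int (f (i', l))"])
        (auto intro: sum_nonneg)
    also have "\<dots> = (\<Sum>i'<Suc i. N i')"
      using flows_cut[OF f, of "Suc i"] il assms by simp
    finally have "f (i, l) \<le> nat (\<Sum>i'<Suc i. N i')" by simp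
    also have "\<dots> \<le> (\<Sum>i<j. nat (\<Sum>i'<Suc i. N i'))"
      by (rule member_le_sum[where f = "\<lambda>i. nat (\<Sum>i'<Suc i. N i')"]) (use il in auto)
    finally show ?thesis using assms by simp
  qed
  then show "f \<in> bnd (edges n j) R"
    using f by (auto simp: bnd_def flows_def)
qed

lemma finite_flows: "j \<le> n \<Longrightarrow> finite (flows n j N)"
  using finite_subset[OF flows_subset_bnd[OF _ order.refl] finite_bnd] by simp

text \<open>For \<open>j = n\<close> and \<open>y = 1\<close> this is the number of flows.\<close>
definition flow_gf :: "nat \<Rightarrow> nat \<Rightarrow> (nat \<Rightarrow> int) \<Rightarrow> (nat \<Rightarrow> real) \<Rightarrow> real" where
  "flow_gf n j N y = (\<Sum>f\<in>flows n j N. \<Prod>l\<in>{j..n}. y l ^ (\<Sum>i<j. f (i, l)))"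

text \<open>The witness is the path flow: vertex \<open>i\<close> sends everything that has
  accumulated, namely s_i, to vertex i + 1.\<close>

lemma flow_gf_pos:
  assumes "j \<le> n" "\<And>l. y l > 0" "\<And>i. i < j \<Longrightarrow> (\<Sum>i'<Suc i. N i') \<ge> 0"
  shows "flow_gf n j N y > 0"
proof -
  define f where "f e = (if e \<in> edges n j \<and> snd e = Suc (fst e) then nat (\<Sum>i<snd e. N i) else 0)" for e
  have out: "(\<Sum>l\<in>{i<..n}. int (f (i, l))) = (\<Sum>i'<Suc i. N i')" if "i < j" for i
  proof -
    have "(\<Sum>l\<in>{i<..n}. int (f (i, l))) = (\<Sum>l\<in>{i<..n}. if l = Suc i then \<Sum>i'<Suc i. N i' else 0)"
      using that assms(3)[of i] by (intro sum.cong) (auto simp: f_def edges_iff)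
    then show ?thesis using that assms(1) by simp
  qed
  have "in": "(\<Sum>k<i. int (f (k, i))) = (\<Sum>i'<i. N i')" if "i < j" for i
  proof (cases i)
    case (Suc k)
    have "(\<Sum>k'<i. int (f (k', i))) = (\<Sum>k'<i. if k' = k then \<Sum>i'<i. N i' else 0)"
      using that assms(1) assms(3)[of k] Suc by (intro sum.cong) (auto simp: f_def edges_iff)
    then show ?thesis using Suc by simp
  qed simp
  have "f \<in> flows n j N"
    unfolding flows_def using out "in" by (auto simp: f_def)
  then show ?thesis unfolding flow_gf_def
    using assms by (intro sum_pos finite_flows prod_pos) auto
qed

text \<open>Merging the vertices above \<open>j\<close> into the single vertex \<open>j + 1\<close>, with \<open>y l\<close> as the weight
  of the edges into \<open>l\<close>, turns the values of the generating function into entries of one array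
  of weighted flows along the direction from \<open>j + 1\<close> to \<open>j\<close>.\<close>
lemma flow_gf_log_concave:
  fixes N :: "nat \<Rightarrow> int"
  assumes "j < n" "\<And>l. y l > 0"
  defines "S \<equiv> (\<Sum>i<j. N i)"
  defines "a \<equiv> (\<lambda>k. flow_gf n (Suc j) (N(j := int k - S)) y)"
  shows "a k * a (Suc (Suc k)) \<le> (a (Suc k))\<^sup>2"
proof -
  define V where "V = {..Suc j}"
  define E where "E = edges n (Suc j)"
  define tgt where "tgt e = min (snd e) (Suc j)" for e :: "nat \<times> nat"
  define w where "w e = (if snd e \<le> j then 1 else y (snd e))" for e :: "nat \<times> nat"
  \<comment> \<open>The entry -k at the merged vertex is forced by balance, so raising
    \<open>k\<close> by one adds e_j - e_{j+1}.\<close>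
  define \<gamma> where "\<gamma> k v = (if v < j then N v else if v = j then int k - S else - int k)" for k :: nat and v
  define B where "B k = (\<Sum>i<Suc j. nat (\<Sum>i'<Suc i. (N(j := int k - S)) i'))" for k :: nat
  \<comment> \<open>One cap that is large enough for the three consecutive values of
    \<open>k\<close> in the inequality.\<close>
  define R where "R = B k + B (Suc k) + B (Suc (Suc k))"
  have a_eq: "a k = weighted_flows V fst tgt w R E (\<gamma> k)" if "B k \<le> R" for k
  proof -
    have net1: "net fst tgt E f v = (\<Sum>l\<in>{v<..n}. int (f (v, l))) - (\<Sum>k<v. int (f (k, v)))"
      if "v \<le> j" for f v
    proof -
      have "net fst tgt E f v = (\<Sum>(i, l)\<in>E. (if i = v then int (f (i, l)) else 0) - (if l = v then int (f (i, l)) else 0))"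
        unfolding net_def using that by (intro sum.cong) (auto simp: tgt_def)
      also have "\<dots> = (\<Sum>i<Suc j. \<Sum>l\<in>{i<..n}. if i = v then int (f (i, l)) else 0)
          - (\<Sum>i<Suc j. \<Sum>l\<in>{i<..n}. if l = v then int (f (i, l)) else 0)"
        unfolding E_def edges_def by (simp add: sum.Sigma[symmetric] sum_subtractf del: sum.lessThan_Suc)
      also have "(\<Sum>i<Suc j. \<Sum>l\<in>{i<..n}. if i = v then int (f (i, l)) else 0)
          = (\<Sum>i<Suc j. if i = v then \<Sum>l\<in>{v<..n}. int (f (v, l)) else 0)"
        by (intro sum.cong refl) auto
      also have "\<dots> = (\<Sum>l\<in>{v<..n}. int (f (v, l)))" using that by (simp del: sum.lessThan_Suc)
      also have "(\<Sum>i<Suc j. \<Sum>l\<in>{i<..n}. if l = v then int (f (i, l)) else 0)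
          = (\<Sum>i<Suc j. if i < v then int (f (i, v)) else 0)"
        using that assms(1) by (intro sum.cong refl) (auto simp del: sum.lessThan_Suc)
      also have "\<dots> = (\<Sum>i\<in>{i\<in>{..<Suc j}. i < v}. int (f (i, v)))"
        by (rule sum.inter_filter[symmetric]) simp
      also have "{i\<in>{..<Suc j}. i < v} = {..<v}" using that by auto
      finally show ?thesis .
    qed
    have net2: "net fst tgt E f (Suc j) = - (\<Sum>i<Suc j. \<Sum>l\<in>{Suc j..n}. int (f (i, l)))" for f
    proof -
      have "net fst tgt E f (Suc j) = (\<Sum>(i, l)\<in>E. - (if Suc j \<le> l then int (f (i, l)) else 0))"
        unfolding net_def E_def by (intro sum.cong) (auto simp: tgt_def edges_iff)
      also have "\<dots> = - (\<Sum>i<Suc j. \<Sum>l\<in>{i<..n}. if Suc j \<le> l then int (f (i, l)) else 0)"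
        unfolding E_def edges_def by (simp add: sum.Sigma[symmetric] sum_negf del: sum.lessThan_Suc)
      also have "(\<Sum>i<Suc j. \<Sum>l\<in>{i<..n}. if Suc j \<le> l then int (f (i, l)) else 0)
          = (\<Sum>i<Suc j. \<Sum>l\<in>{Suc j..n}. int (f (i, l)))"
      proof (rule sum.cong[OF refl])
        fix i assume "i \<in> {..<Suc j}"
        then have "{l\<in>{i<..n}. Suc j \<le> l} = {Suc j..n}" by auto
        then show "(\<Sum>l\<in>{i<..n}. if Suc j \<le> l then int (f (i, l)) else 0) = (\<Sum>l\<in>{Suc j..n}. int (f (i, l)))"
          by (simp add: sum.inter_filter[symmetric])
      qed
      finally show ?thesis .
    qed
    let ?N = "N(j := int k - S)"
    have sumN: "(\<Sum>i<Suc j. ?N i) = int k" by (simp add: S_def)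
    have "flows n (Suc j) ?N = {f \<in> bnd E R. \<forall>v\<in>V. net fst tgt E f v = \<gamma> k v}"
    proof (intro equalityI subsetI)
      fix f assume f: "f \<in> flows n (Suc j) ?N"
      have "f \<in> bnd E R"
        using flows_subset_bnd[of "Suc j" n ?N R] that assms(1) f by (auto simp: E_def B_def)
      moreover have "net fst tgt E f v = \<gamma> k v" if "v \<in> V" for v
      proof (cases "v \<le> j")
        case True
        then show ?thesis using f unfolding net1[OF True] by (auto simp: flows_def \<gamma>_def)
      next
        case False
        then have v: "v = Suc j" using that by (simp add: V_def)
        show ?thesis
          using flows_cut[OF f, of "Suc j"] assms(1) sumN unfolding v net2 by (simp add: \<gamma>_def)
      qed
      ultimately show "f \<in> {f \<in> bnd E R. \<forall>v\<in>V. net fst tgt E f v = \<gamma> k v}" by blast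
    next
      fix f assume f: "f \<in> {f \<in> bnd E R. \<forall>v\<in>V. net fst tgt E f v = \<gamma> k v}"
      have "(\<Sum>l\<in>{i<..n}. int (f (i, l))) - (\<Sum>k<i. int (f (k, i))) = ?N i" if "i < Suc j" for i
      proof -
        have "net fst tgt E f i = \<gamma> k i" using f that by (simp add: V_def)
        then show ?thesis using that net1[of i f] by (auto simp: \<gamma>_def)
      qed
      then show "f \<in> flows n (Suc j) ?N"
        using f by (auto simp: flows_def bnd_def E_def)
    qed
    moreover have "(\<Prod>e\<in>E. w e ^ f e) = (\<Prod>l\<in>{Suc j..n}. y l ^ (\<Sum>i<Suc j. f (i, l)))" for f
    proof -
      have "(\<Prod>e\<in>E. w e ^ f e) = (\<Prod>i<Suc j. \<Prod>l\<in>{i<..n}. w (i, l) ^ f (i, l))"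
        unfolding E_def edges_def by (simp add: prod.Sigma del: prod.lessThan_Suc)
      also have "\<dots> = (\<Prod>i<Suc j. \<Prod>l\<in>{Suc j..n}. y l ^ f (i, l))"
        by (intro prod.cong refl prod.mono_neutral_cong_right) (auto simp: w_def)
      also have "\<dots> = (\<Prod>l\<in>{Suc j..n}. \<Prod>i<Suc j. y l ^ f (i, l))"
        by (rule prod.swap)
      finally show ?thesis by (simp add: power_sum del: prod.lessThan_Suc sum.lessThan_Suc)
    qed
    ultimately show ?thesis
      unfolding a_def flow_gf_def weighted_flows_def by simp
  qed
  have EV: "fst e \<in> V \<and> tgt e \<in> V \<and> w e > 0" if "e \<in> E" for e
    using that assms(2) by (cases e) (auto simp: E_def edges_iff V_def tgt_def w_def)
  have "weighted_flows V fst tgt w R E (\<lambda>v. \<gamma> (Suc k) v + (unitv j v - unitv (Suc j) v)) *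
        weighted_flows V fst tgt w R E (\<lambda>v. \<gamma> (Suc k) v - (unitv j v - unitv (Suc j) v))
      \<le> (weighted_flows V fst tgt w R E (\<gamma> (Suc k)))\<^sup>2"
    by (rule weighted_flows_log_concave) (use EV in \<open>auto simp: E_def V_def\<close>)
  moreover have "weighted_flows V fst tgt w R E (\<lambda>v. \<gamma> (Suc k) v + (unitv j v - unitv (Suc j) v))
      = weighted_flows V fst tgt w R E (\<gamma> (Suc (Suc k)))"
    unfolding weighted_flows_def by (intro sum.cong Collect_cong refl conj_cong ball_cong)
      (auto simp: \<gamma>_def unitv_def V_def)
  moreover have "weighted_flows V fst tgt w R E (\<lambda>v. \<gamma> (Suc k) v - (unitv j v - unitv (Suc j) v))
      = weighted_flows V fst tgt w R E (\<gamma> k)"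
    unfolding weighted_flows_def by (intro sum.cong Collect_cong refl conj_cong ball_cong)
      (auto simp: \<gamma>_def unitv_def V_def)
  ultimately show ?thesis
    using a_eq[of k] a_eq[of "Suc k"] a_eq[of "Suc (Suc k)"] by (simp add: R_def mult.commute)
qed

section \<open>The geometric entropy and one-variable estimates\<close>

text \<open>The exponential of the entropy of the geometric distribution with mean \<open>x\<close>.\<close>
definition geo_ent :: "real \<Rightarrow> real" where
  "geo_ent x = selfpow (x + 1) / selfpow x"

lemma selfpow_pos: "selfpow x > 0"
  by (simp add: selfpow_def)

lemma selfpow_exp: "x > 0 \<Longrightarrow> selfpow x = exp (x * ln x)"
  by (simp add: selfpow_def powr_def)

lemma geo_ent_pos: "geo_ent x > 0"
  by (simp add: geo_ent_def selfpow_pos)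

lemma geo_ent_0 [simp]: "geo_ent 0 = 1"
  by (simp add: geo_ent_def selfpow_def)

lemma geo_ent_exp: "x > 0 \<Longrightarrow> geo_ent x = exp ((x + 1) * ln (x + 1) - x * ln x)"
  by (simp add: geo_ent_def selfpow_exp exp_diff)

text \<open>On (0, 1) the function (1 - q) q^x is largest at q = x / (1 + x). The proof applies ln u
  \<le> u - 1 to the ratios of 1 - q and q to their optimal values, with weights 1 and x; the
  right-hand sides then cancel.\<close>

lemma geometric_series_ge_geo_ent:
  assumes "0 < q" "q < 1" "x \<ge> 0"
  shows "geo_ent x * q powr x \<le> 1 / (1 - q)"
proof (cases "x = 0")
  case True
  then show ?thesis using assms by (simp add: divide_simps)
next
  case False
  then have x: "x > 0" using assms by simp
  have "ln ((1 - q) * (1 + x)) \<le> (1 - q) * (1 + x) - 1"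
    using assms x by (intro ln_le_minus_one) simp
  moreover have "x * ln (q * (1 + x) / x) \<le> x * (q * (1 + x) / x - 1)"
    using assms x by (intro mult_left_mono ln_le_minus_one) auto
  moreover have "x * (q * (1 + x) / x - 1) = q * (1 + x) - x"
    using x by (simp add: field_simps)
  ultimately have "ln ((1 - q) * (1 + x)) + x * ln (q * (1 + x) / x) \<le> 0"
    by (simp add: algebra_simps)
  then have "ln (1 - q) + ln (1 + x) + x * (ln q + ln (1 + x) - ln x) \<le> 0"
    using assms x by (simp add: ln_mult ln_div)
  then have le: "(x + 1) * ln (x + 1) - x * ln x + x * ln q \<le> - ln (1 - q)"
    by (simp add: algebra_simps)
  have "geo_ent x * q powr x = exp ((x + 1) * ln (x + 1) - x * ln x + x * ln q)"
    using assms x by (simp add: geo_ent_exp powr_def exp_add)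
  also have "\<dots> \<le> exp (- ln (1 - q))" using le by simp
  also have "\<dots> = 1 / (1 - q)" using assms by (simp add: exp_minus inverse_eq_divide)
  finally show ?thesis .
qed

text \<open>The supremum of x^m (1 - x) on (0, 1) is 1 / g(m), attained at m / (m + 1). For m = 0 it
  is only approached as x tends to 0, hence the limit.\<close>

lemma divide_geo_ent_le:
  fixes B X :: real
  assumes "\<And>x. 0 < x \<Longrightarrow> x < 1 \<Longrightarrow> B * x ^ m * (1 - x) \<le> X"
  shows "B / geo_ent (real m) \<le> X"
proof (cases "m = 0")
  case True
  have "((\<lambda>x. B * (1 - x)) \<longlongrightarrow> B * (1 - 0)) (at_right 0)"
    by (intro tendsto_intros)
  moreover have "\<forall>\<^sub>F x in at_right (0::real). B * (1 - x) \<le> X"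
    unfolding eventually_at_right_field using assms True by (auto intro!: exI[of _ 1])
  ultimately have "B * (1 - 0) \<le> X"
    by (intro tendsto_upperbound[where F = "at_right (0::real)"]) auto
  then show ?thesis using True by simp
next
  case False
  define x where "x = real m / (real m + 1)"
  have x: "0 < x" "x < 1" using False by (auto simp: x_def)
  have "1 / geo_ent (real m) = real m ^ m / (real m + 1) ^ (m + 1)"
    using False powr_realpow[of "real m" m] powr_realpow[of "real m + 1" "m + 1"]
    by (simp add: geo_ent_def selfpow_def add_ac)
  also have "\<dots> = x ^ m * (1 - x)"
  proof -
    have "1 - x = 1 / (real m + 1)" by (simp add: x_def field_simps)
    then show ?thesis by (simp add: x_def power_divide)
  qed
  finally have "B / geo_ent (real m) = B * x ^ m * (1 - x)"
    by (metis mult.assoc mult.right_neutral times_divide_eq_right)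
  then show ?thesis using assms[OF x] by simp
qed

text \<open>The ratios of consecutive terms decrease, so the geometric sequence through a_m with the
  ratio found at \<open>m\<close> dominates on both sides of \<open>m\<close>.\<close>

lemma log_concave_le_geometric:
  fixes a :: "nat \<Rightarrow> real"
  assumes pos: "\<And>k. a k > 0" and lc: "\<And>k. a k * a (Suc (Suc k)) \<le> (a (Suc k))\<^sup>2"
  obtains \<rho> where "\<rho> > 0" "\<And>k. a k * \<rho> ^ m \<le> a m * \<rho> ^ k"
proof -
  define r where "r k = a (Suc k) / a k" for k
  have "r (Suc k) \<le> r k" for k
    using lc[of k] pos[of k] pos[of "Suc k"]
    by (simp add: r_def divide_simps power2_eq_square mult_ac)
  then have r_mono: "r l \<le> r k" if "k \<le> l" for k l
    using that by (rule lift_Suc_antimono_le)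
  define \<rho> where "\<rho> = r m"
  have \<rho>: "\<rho> > 0" using pos by (simp add: \<rho>_def r_def)
  have a_Suc: "a (Suc k) = r k * a k" for k using pos[of k] by (simp add: r_def)
  have "a k * \<rho> ^ m \<le> a m * \<rho> ^ k" for k
  proof (cases "m \<le> k")
    case True
    then show ?thesis
    proof (induction k rule: dec_induct)
      case (step k)
      have "a (Suc k) * \<rho> ^ m = r k * (a k * \<rho> ^ m)" by (simp add: a_Suc)
      also have "\<dots> \<le> \<rho> * (a m * \<rho> ^ k)"
        by (rule mult_mono) (use step r_mono[of m k] \<rho> pos[of k] in \<open>auto simp: \<rho>_def less_imp_le\<close>)
      finally show ?case by (simp add: mult_ac)
    qed simp
  next
    case False
    then have "k \<le> m" by simp
    then show ?thesis
    proof (induction k rule: inc_induct)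
      case (step k)
      have "\<rho> * (a k * \<rho> ^ m) \<le> r k * (a k * \<rho> ^ m)"
        using step r_mono[of k m] \<rho> pos[of k] by (intro mult_right_mono) (auto simp: \<rho>_def less_imp_le)
      also have "\<dots> = a (Suc k) * \<rho> ^ m" by (simp add: a_Suc)
      also have "\<dots> \<le> \<rho> * (a m * \<rho> ^ k)" using step by (simp add: mult_ac)
      finally show ?case using \<rho> by simp
    qed simp
  qed
  with \<rho> show thesis by (rule that)
qed

section \<open>Extraction of one coefficient per vertex\<close>

text \<open>Expanding the product chooses the flow on the edges leaving \<open>j\<close>. Each unit
  leaving \<open>j\<close> carries \<open>t\<close>, and each unit arriving there carries 1 / t
  through y_j, so the power of \<open>t\<close> records the net flow at \<open>j\<close>, shifted by
  \<open>S\<close>. Capping the choices at \<open>R\<close> leaves only part of the flows, hence the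
  inequality.\<close>

lemma flow_gf_series_le:
  fixes N :: "nat \<Rightarrow> int"
  assumes jn: "j < n" and y: "\<And>l. y l > 0" and t: "t > 0" and S: "int S = (\<Sum>i<j. N i)"
  shows "\<exists>K.
    (\<Prod>l\<in>{j<..n}. \<Sum>r\<le>R. (t * y l) ^ r) * (t ^ S * flow_gf n j N (y(j := 1 / t)))
     \<le> (\<Sum>k\<le>K. flow_gf n (Suc j) (N(j := int k - int S)) y * t ^ k)"
proof -
  define row where "row = Pair j ` {j<..n}"
  define inn where "inn f = (\<Sum>i<j. f (i, j))" for f :: "nat \<times> nat \<Rightarrow> nat"
  define out where "out r = (\<Sum>l\<in>{j<..n}. r (j, l))" for r :: "nat \<times> nat \<Rightarrow> nat"
  define D where "D = flows n j N \<times> bnd row R"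
  \<comment> \<open>The shift by \<open>S\<close> keeps the index a natural number: by the cut
    identity at most \<open>S\<close> units arrive at \<open>j\<close>.\<close>
  define \<Phi> where "\<Phi> = (\<lambda>(f, r). (S + out r - inn f, \<lambda>e. f e + r e :: nat))"
  define h where "h f = (\<Prod>l\<in>{Suc j..n}. y l ^ (\<Sum>i<Suc j. f (i, l)))" for f :: "nat \<times> nat \<Rightarrow> nat"
  define Fl where "Fl k = flows n (Suc j) (N(j := int k - int S))" for k
  define K where "K = S + n * R"
  have fin: "finite D" unfolding D_def row_def
    using jn by (intro finite_cartesian_product finite_flows finite_bnd) auto
  have finFl: "finite (Fl k)" for k
    unfolding Fl_def using jn by (intro finite_flows) simp
  have f0: "f e = 0" if "f \<in> flows n j N" "e \<notin> edges n j" for f e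
    using that unfolding flows_def by blast
  have r0: "r e = 0" if "r \<in> bnd row R" "e \<notin> row" for r e
    using that by (rule bnd_eq_0)
  have inn_le: "inn f \<le> S" if "f \<in> flows n j N" for f
  proof -
    have "int (inn f) = (\<Sum>i<j. int (f (i, j)))" by (simp add: inn_def)
    also have "\<dots> \<le> (\<Sum>i<j. \<Sum>l\<in>{j..n}. int (f (i, l)))"
      using jn by (intro sum_mono member_le_sum) auto
    also have "\<dots> = int S" using flows_cut[OF that, of j] jn S by simp
    finally show ?thesis by simp
  qed
  have out_le: "out r \<le> n * R" if "r \<in> bnd row R" for r
  proof -
    have "out r \<le> (\<Sum>l\<in>{j<..n}. R)"
      unfolding out_def using that by (intro sum_mono) (auto simp: bnd_def row_def split: if_splits)
    also have "\<dots> \<le> n * R" by simp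
    finally show ?thesis .
  qed
  have inj: "inj_on \<Phi> D"
  proof (rule inj_onI, clarify)
    fix f r f' r' assume "(f, r) \<in> D" "(f', r') \<in> D" and eq: "\<Phi> (f, r) = \<Phi> (f', r')"
    then have fr: "f \<in> flows n j N" "r \<in> bnd row R" "f' \<in> flows n j N" "r' \<in> bnd row R"
      by (auto simp: D_def)
    have e: "f e + r e = f' e + r' e" for e
      using eq by (auto simp: \<Phi>_def dest: fun_cong)
    have "f e = f' e \<and> r e = r' e" for e
    proof (cases "e \<in> row")
      case True
      then have "e \<notin> edges n j" using edges_disjoint by (auto simp: row_def)
      then show ?thesis using e[of e] f0[OF fr(1), of e] f0[OF fr(3), of e] by simp
    next
      case False
      then show ?thesis using e[of e] r0[OF fr(2), of e] r0[OF fr(4), of e] by simp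
    qed
    then show "f = f' \<and> r = r'" by auto
  qed
  have image: "\<Phi> ` D \<subseteq> Sigma {..K} Fl"
  proof (clarify)
    fix f r k g assume "(f, r) \<in> D" and "(k, g) = \<Phi> (f, r)"
    then have fr: "f \<in> flows n j N" "r \<in> bnd row R" and k: "k = S + out r - inn f"
      and g: "g = (\<lambda>e. f e + r e)" by (auto simp: D_def \<Phi>_def)
    have "(\<Sum>l\<in>{i<..n}. int (g (i, l))) - (\<Sum>k<i. int (g (k, i))) = (N(j := int k - int S)) i"
      if "i < Suc j" for i
    proof -
      have g1: "g (k, i) = f (k, i)" if "k < i" for k
      proof -
        have "(k, i) \<notin> row" using that \<open>i < Suc j\<close> by (auto simp: row_def)
        then show ?thesis using r0[OF fr(2)] by (simp add: g)
      qed
      show ?thesis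
      proof (cases "i = j")
        case True
        have "g (j, l) = r (j, l)" for l
          using f0[OF fr(1), of "(j, l)"] by (simp add: g edges_iff)
        then show ?thesis
          using True g1 inn_le[OF fr(1)] by (simp add: k out_def inn_def)
      next
        case False
        then have "(i, l) \<notin> row" for l by (auto simp: row_def)
        then have "g (i, l) = f (i, l)" for l using r0[OF fr(2)] by (simp add: g)
        then show ?thesis using False that g1 fr(1) by (auto simp: flows_def)
      qed
    qed
    moreover have "g e = 0" if "e \<notin> edges n (Suc j)" for e
      using that f0[OF fr(1)] r0[OF fr(2)] by (auto simp: g edges_Suc row_def)
    ultimately have "g \<in> Fl k" by (auto simp: Fl_def flows_def)
    moreover have "k \<le> K" using out_le[OF fr(2)] by (simp add: k K_def)
    ultimately show "k \<in> {..K} \<and> g \<in> Fl k" by simp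
  qed
  have term_eq: "(\<Prod>e\<in>row. (t * y (snd e)) ^ r e) *
       (t ^ S * (\<Prod>l\<in>{j..n}. (y(j := 1 / t)) l ^ (\<Sum>i<j. f (i, l))))
     = (case \<Phi> (f, r) of (k, g) \<Rightarrow> h g * t ^ k)" if "(f, r) \<in> D" for f r
  proof -
    have fr: "f \<in> flows n j N" "r \<in> bnd row R" using that by (auto simp: D_def)
    have I: "{j..n} = insert j {Suc j..n}" "{j<..n} = {Suc j..n}" using jn by auto
    have "(\<Prod>e\<in>row. (t * y (snd e)) ^ r e) = (\<Prod>l\<in>{Suc j..n}. (t * y l) ^ r (j, l))"
      unfolding row_def I by (subst prod.reindex) (auto simp: inj_on_def)
    also have "\<dots> = t ^ out r * (\<Prod>l\<in>{Suc j..n}. y l ^ r (j, l))"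
      by (simp add: power_mult_distrib prod.distrib power_sum out_def I)
    finally have 1: "(\<Prod>e\<in>row. (t * y (snd e)) ^ r e) = t ^ out r * (\<Prod>l\<in>{Suc j..n}. y l ^ r (j, l))" .
    have "(\<Prod>l\<in>{Suc j..n}. (y(j := 1 / t)) l ^ (\<Sum>i<j. f (i, l))) = (\<Prod>l\<in>{Suc j..n}. y l ^ (\<Sum>i<j. f (i, l)))"
      by (intro prod.cong) auto
    then have 2: "(\<Prod>l\<in>{j..n}. (y(j := 1 / t)) l ^ (\<Sum>i<j. f (i, l)))
        = (1 / t) ^ inn f * (\<Prod>l\<in>{Suc j..n}. y l ^ (\<Sum>i<j. f (i, l)))"
      unfolding I by (simp add: inn_def)
    have "t ^ out r * t ^ S = t ^ inn f * t ^ (S + out r - inn f)"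
      using inn_le[OF fr(1)] by (simp add: power_add[symmetric] add_ac)
    then have 3: "t ^ out r * t ^ S * (1 / t) ^ inn f = t ^ (S + out r - inn f)"
      using t by (simp add: power_divide)
    have "f (j, l) = 0" for l using f0[OF fr(1), of "(j, l)"] by (simp add: edges_iff)
    moreover have "r (i, l) = 0" if "i < j" for i l
      by (rule r0[OF fr(2)]) (use that in \<open>auto simp: row_def\<close>)
    ultimately have "(\<Sum>i<Suc j. f (i, l) + r (i, l)) = r (j, l) + (\<Sum>i<j. f (i, l))" for l
      by simp
    then have 4: "h (\<lambda>e. f e + r e) = (\<Prod>l\<in>{Suc j..n}. y l ^ r (j, l)) * (\<Prod>l\<in>{Suc j..n}. y l ^ (\<Sum>i<j. f (i, l)))"
      unfolding h_def by (simp only: power_add prod.distrib)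
    show ?thesis unfolding 1 2 \<Phi>_def by (simp add: 3[symmetric] 4 mult_ac)
  qed
  have "(\<Prod>l\<in>{j<..n}. \<Sum>r\<le>R. (t * y l) ^ r) = (\<Prod>e\<in>row. \<Sum>r\<le>R. (t * y (snd e)) ^ r)"
    unfolding row_def by (subst prod.reindex) (auto simp: inj_on_def)
  also have "\<dots> = (\<Sum>r\<in>bnd row R. \<Prod>e\<in>row. (t * y (snd e)) ^ r e)"
    by (rule sum_bnd_prod_power[symmetric]) (simp add: row_def)
  finally have "(\<Prod>l\<in>{j<..n}. \<Sum>r\<le>R. (t * y l) ^ r) * (t ^ S * flow_gf n j N (y(j := 1 / t)))
    = (\<Sum>(f, r)\<in>D. (\<Prod>e\<in>row. (t * y (snd e)) ^ r e) *
       (t ^ S * (\<Prod>l\<in>{j..n}. (y(j := 1 / t)) l ^ (\<Sum>i<j. f (i, l)))))"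
    unfolding D_def flow_gf_def sum.cartesian_product[symmetric] sum_distrib_left[of "t ^ S"]
    by (simp only: sum_product) (rule sum.swap)
  also have "\<dots> = (\<Sum>p\<in>D. case \<Phi> p of (k, g) \<Rightarrow> h g * t ^ k)"
    using term_eq by (intro sum.cong) auto
  also have "\<dots> = (\<Sum>(k, g)\<in>\<Phi> ` D. h g * t ^ k)"
    by (simp add: sum.reindex[OF inj])
  also have "\<dots> \<le> (\<Sum>(k, g)\<in>Sigma {..K} Fl. h g * t ^ k)"
  proof (rule sum_mono2[OF _ image])
    show "finite (Sigma {..K} Fl)"
      using finFl by (intro finite_SigmaI) auto
    have "h g \<ge> 0" for g
      unfolding h_def using y by (intro prod_nonneg) (simp add: less_imp_le)
    then show "0 \<le> (case p of (k, g) \<Rightarrow> h g * t ^ k)" for p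
      using t by (cases p) simp
  qed
  also have "\<dots> = (\<Sum>k\<le>K. \<Sum>g\<in>Fl k. h g * t ^ k)"
    using finFl by (subst sum.Sigma) auto
  also have "\<dots> = (\<Sum>k\<le>K. flow_gf n (Suc j) (N(j := int k - int S)) y * t ^ k)"
    by (simp add: flow_gf_def h_def Fl_def sum_distrib_right)
  finally show ?thesis by (rule exI)
qed

text \<open>The wanted value is the term a_m, since m - S = N_j. At t = x / \<rho> the geometric
  majorant through a_m bounds the whole series by a_m \<rho>^(-m) / (1 - x). Comparing with B t^m
  and optimising over \<open>x\<close> loses exactly the factor g(m).\<close>

lemma flow_gf_step:
  fixes N :: "nat \<Rightarrow> int"
  assumes jn: "j < n" and y: "\<And>l. y l > 0"
    and N: "\<And>i. i \<le> j \<Longrightarrow> (\<Sum>i'<Suc i. N i') \<ge> 0"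
    and S: "int S = (\<Sum>i<j. N i)" and m: "int m = (\<Sum>i<Suc j. N i)"
    and B: "\<And>t. t > 0 \<Longrightarrow> (\<And>l. l \<in> {j<..n} \<Longrightarrow> t * y l < 1) \<Longrightarrow>
       B * t ^ m \<le> (\<Prod>l\<in>{j<..n}. 1 / (1 - t * y l)) * (t ^ S * flow_gf n j N (y(j := 1 / t)))"
  shows "B / geo_ent (real m) \<le> flow_gf n (Suc j) N y"
proof -
  define a where "a k = flow_gf n (Suc j) (N(j := int k - int S)) y" for k
  have a_pos: "a k > 0" for k
    unfolding a_def
  proof (rule flow_gf_pos)
    fix i assume "i < Suc j"
    show "(\<Sum>i'<Suc i. (N(j := int k - int S)) i') \<ge> 0"
    proof (cases "i = j")
      case True then show ?thesis using S by simp
    next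
      case False
      then have "(\<Sum>i'<Suc i. (N(j := int k - int S)) i') = (\<Sum>i'<Suc i. N i')"
        using \<open>i < Suc j\<close> by (intro sum.cong) auto
      then show ?thesis using N[of i] \<open>i < Suc j\<close> by simp
    qed
  qed (use jn y in auto)
  have a_lc: "a k * a (Suc (Suc k)) \<le> (a (Suc k))\<^sup>2" for k
    unfolding a_def S using jn y by (rule flow_gf_log_concave)
  have "N(j := int m - int S) = N" using S m by auto
  then have am: "a m = flow_gf n (Suc j) N y" by (simp add: a_def)
  obtain \<rho> where \<rho>: "\<rho> > 0" "\<And>k. a k * \<rho> ^ m \<le> a m * \<rho> ^ k"
    using log_concave_le_geometric[of a m] a_pos a_lc by blast
  have "B * x ^ m * (1 - x) \<le> a m" if x: "0 < x" "x < 1" for x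
  proof -
    define t where "t = x / \<rho>"
    have t: "t > 0" and x_eq: "x = \<rho> * t" using x \<rho> by (auto simp: t_def)
    define c where "c = t ^ S * flow_gf n j N (y(j := 1 / t))"
    have c: "c > 0" unfolding c_def using t jn y N by (intro mult_pos_pos flow_gf_pos) auto
    define C where "C = a m / \<rho> ^ m / (1 - x)"
    have bound: "(\<Prod>l\<in>{j<..n}. \<Sum>r\<le>R. (t * y l) ^ r) * c \<le> C" for R
    proof -
      have "\<exists>K. (\<Prod>l\<in>{j<..n}. \<Sum>r\<le>R. (t * y l) ^ r) * c \<le> (\<Sum>k\<le>K. a k * t ^ k)"
        unfolding a_def c_def by (rule flow_gf_series_le[OF jn y t S])
      then obtain K where "(\<Prod>l\<in>{j<..n}. \<Sum>r\<le>R. (t * y l) ^ r) * c \<le> (\<Sum>k\<le>K. a k * t ^ k)"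
        by (elim exE)
      also have "\<dots> \<le> (\<Sum>k\<le>K. a m / \<rho> ^ m * x ^ k)"
      proof (rule sum_mono)
        fix k
        have "a k \<le> a m / \<rho> ^ m * \<rho> ^ k" using \<rho>(2)[of k] \<rho>(1) by (simp add: field_simps)
        then have "a k * t ^ k \<le> a m / \<rho> ^ m * \<rho> ^ k * t ^ k"
          using t by (intro mult_right_mono) auto
        then show "a k * t ^ k \<le> a m / \<rho> ^ m * x ^ k"
          by (simp add: x_eq power_mult_distrib)
      qed
      also have "\<dots> = a m / \<rho> ^ m * (\<Sum>k\<le>K. x ^ k)" by (simp add: sum_distrib_left)
      also have "\<dots> \<le> a m / \<rho> ^ m * (1 / (1 - x))"
        using x \<rho>(1) a_pos[of m]
        by (intro mult_left_mono) (simp_all add: sum_gp0 divide_right_mono)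
      finally show ?thesis by (simp add: C_def)
    qed
    \<comment> \<open>Convergence is forced: if t y_l \<ge> 1, the truncated products would grow at
      least like R + 1, against the uniform bound \<open>C\<close>.\<close>
    have lt1: "t * y l < 1" if l: "l \<in> {j<..n}" for l
    proof (rule ccontr)
      assume "\<not> t * y l < 1"
      then have ge: "1 \<le> t * y l" by simp
      have "(real R + 1) * c \<le> C" for R
      proof -
        have "real R + 1 = (\<Sum>r\<le>R. 1)" by simp
        also have "\<dots> \<le> (\<Sum>r\<le>R. (t * y l) ^ r)" using ge by (intro sum_mono) simp
        also have "\<dots> \<le> (\<Sum>r\<le>R. (t * y l) ^ r) * (\<Prod>l\<in>{j<..n} - {l}. \<Sum>r\<le>R. (t * y l) ^ r)"
        proof -
          have "1 \<le> (\<Sum>r\<le>R. (t * y l) ^ r)" for l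
            using member_le_sum[of 0 "{..R}" "\<lambda>r. (t * y l) ^ r"] t y[of l] by simp
          then have P1: "1 \<le> (\<Prod>l\<in>{j<..n} - {l}. \<Sum>r\<le>R. (t * y l) ^ r)"
            by (intro prod_ge_1) auto
          have P2: "0 \<le> (\<Sum>r\<le>R. (t * y l) ^ r)" using ge by (intro sum_nonneg) simp
          show ?thesis using mult_left_mono[OF P1 P2] by (simp only: mult_1_right)
        qed
        also have "\<dots> = (\<Prod>l\<in>{j<..n}. \<Sum>r\<le>R. (t * y l) ^ r)"
          using l by (subst prod.remove[of _ l]) auto
        finally show ?thesis using bound[of R] c by (meson mult_right_mono less_imp_le order_trans)
      qed
      moreover obtain R where "C / c < real R" using reals_Archimedean2 by blast
      ultimately show False using c by (smt (verit) pos_divide_less_eq mult_less_cancel_right)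
    qed
    have "(\<lambda>R. (\<Prod>l\<in>{j<..n}. \<Sum>r\<le>R. (t * y l) ^ r) * c)
        \<longlonglongrightarrow> (\<Prod>l\<in>{j<..n}. 1 / (1 - t * y l)) * c"
    proof (intro tendsto_mult tendsto_prod tendsto_const)
      fix l assume "l \<in> {j<..n}"
      then have "norm (t * y l) < 1" using lt1 t y[of l] by simp
      then show "(\<lambda>R. \<Sum>r\<le>R. (t * y l) ^ r) \<longlonglongrightarrow> 1 / (1 - t * y l)"
        using geometric_sums[of "t * y l"] by (simp add: sums_def_le)
    qed
    then have "(\<Prod>l\<in>{j<..n}. 1 / (1 - t * y l)) * c \<le> C"
      using bound by (intro LIMSEQ_le_const2) auto
    then have "B * t ^ m \<le> C" using B[OF t lt1] unfolding c_def by linarith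
    then have "B * t ^ m * (\<rho> ^ m * (1 - x)) \<le> C * (\<rho> ^ m * (1 - x))"
      using \<rho> x by (intro mult_right_mono) auto
    then show ?thesis
      using \<rho> x by (simp add: C_def x_eq power_mult_distrib mult_ac)
  qed
  then show ?thesis using divide_geo_ent_le[of B m "a m"] am by simp
qed

section \<open>The lower bound attached to a real flow\<close>

text \<open>Induction on \<open>j\<close> with \<open>y\<close> arbitrary, because the step uses the
  previous bound at y_j = 1 / t. The edges leaving \<open>j\<close> bring in their entropies through
  \<open>geometric_series_ge_geo_ent\<close>, and the extraction costs g(s_j).\<close>

lemma flow_gf_ge:
  fixes N :: "nat \<Rightarrow> int" and \<phi> :: "nat \<times> nat \<Rightarrow> real"
  assumes \<phi>: "\<And>e. \<phi> e \<ge> 0"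
    and cons: "\<And>i. i < n \<Longrightarrow> (\<Sum>l\<in>{i<..n}. \<phi> (i, l)) - (\<Sum>k<i. \<phi> (k, i)) = real_of_int (N i)"
    and "j \<le> n" "\<And>l. y l > 0"
  shows "(\<Prod>k<j. 1 / geo_ent (\<Sum>i<Suc k. real_of_int (N i))) * (\<Prod>i<j. \<Prod>l\<in>{i<..n}. geo_ent (\<phi> (i, l)))
     * (\<Prod>l\<in>{j..n}. y l powr (\<Sum>i<j. \<phi> (i, l))) \<le> flow_gf n j N y"
  using assms(3,4)
proof (induction j arbitrary: y)
  case 0
  have "flows n 0 N = {\<lambda>_. 0}" by (auto simp: flows_def edges_def)
  moreover have "(\<Prod>l\<in>{0..n}. y l powr 0) = 1" using 0 by (intro prod.neutral) (auto simp: less_imp_neq[symmetric])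
  ultimately show ?case by (simp add: flow_gf_def)
next
  case (Suc j)
  have jn: "j < n" using Suc.prems by simp
  note y = Suc.prems(2)
  have N_cut: "real_of_int (\<Sum>i<i'. N i) = (\<Sum>i<i'. \<Sum>l\<in>{i'..n}. \<phi> (i, l))" if "i' \<le> n" for i'
    using sum_net_eq_cut[where j = i' and n = n and f = \<phi> and N = "\<lambda>i. real_of_int (N i)"] cons that by simp
  have N_nonneg: "(\<Sum>i<i'. N i) \<ge> 0" if "i' \<le> n" for i'
  proof -
    have "real_of_int (\<Sum>i<i'. N i) \<ge> 0" unfolding N_cut[OF that] using \<phi> by (intro sum_nonneg) auto
    then show ?thesis by linarith
  qed
  define S where "S = nat (\<Sum>i<j. N i)"
  define m where "m = nat (\<Sum>i<Suc j. N i)"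
  have S: "int S = (\<Sum>i<j. N i)" using N_nonneg[of j] jn by (simp add: S_def)
  have m: "int m = (\<Sum>i<Suc j. N i)" using N_nonneg[of "Suc j"] jn by (simp add: m_def)
  define A where "A = (\<Prod>k<j. 1 / geo_ent (\<Sum>i<Suc k. real_of_int (N i))) * (\<Prod>i<j. \<Prod>l\<in>{i<..n}. geo_ent (\<phi> (i, l)))"
  define G where "G = (\<Prod>l\<in>{j<..n}. geo_ent (\<phi> (j, l)))"
  define Y where "Y = (\<Prod>l\<in>{Suc j..n}. y l powr (\<Sum>i<Suc j. \<phi> (i, l)))"
  have A: "A > 0" unfolding A_def by (intro mult_pos_pos prod_pos) (auto simp: geo_ent_pos)
  have I: "{j..n} = insert j {Suc j..n}" "{j<..n} = {Suc j..n}" using jn by auto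
  have real_m: "real m = (\<Sum>i<Suc j. real_of_int (N i))"
    using m by (metis of_int_of_nat_eq of_int_sum)
  have real_S: "real S = (\<Sum>i<j. real_of_int (N i))"
    using S by (metis of_int_of_nat_eq of_int_sum)
  have "A * G * Y / geo_ent (real m) \<le> flow_gf n (Suc j) N y"
  proof (rule flow_gf_step[OF jn y _ S m])
    show "(\<Sum>i'<Suc i. N i') \<ge> 0" if "i \<le> j" for i using N_nonneg[of "Suc i"] that jn by simp
    fix t :: real assume t: "t > 0" and lt1: "\<And>l. l \<in> {j<..n} \<Longrightarrow> t * y l < 1"
    define inn where "inn = (\<Sum>i<j. \<phi> (i, j))"
    \<comment> \<open>Conservation at \<open>j\<close>: the powers of \<open>t\<close> from the
      outgoing edges, from t^S and from y_j = 1 / t combine to exactly t^m.\<close>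
    have m_eq: "real m = (\<Sum>l\<in>{Suc j..n}. \<phi> (j, l)) + real S - inn"
      using cons[OF jn] by (simp add: real_m real_S inn_def I)
    have "A * (\<Prod>l\<in>{j..n}. (y(j := 1 / t)) l powr (\<Sum>i<j. \<phi> (i, l))) \<le> flow_gf n j N (y(j := 1 / t))"
      unfolding A_def by (rule Suc.IH) (use jn y t in auto)
    also have "(\<Prod>l\<in>{j..n}. (y(j := 1 / t)) l powr (\<Sum>i<j. \<phi> (i, l)))
      = t powr (- inn) * (\<Prod>l\<in>{Suc j..n}. y l powr (\<Sum>i<j. \<phi> (i, l)))"
    proof -
      have "(\<Prod>l\<in>{Suc j..n}. (y(j := 1 / t)) l powr (\<Sum>i<j. \<phi> (i, l)))
          = (\<Prod>l\<in>{Suc j..n}. y l powr (\<Sum>i<j. \<phi> (i, l)))" by (intro prod.cong) auto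
      then show ?thesis unfolding I using t by (simp add: inn_def powr_minus_divide powr_divide)
    qed
    finally have 1: "A * (t powr (- inn) * (\<Prod>l\<in>{Suc j..n}. y l powr (\<Sum>i<j. \<phi> (i, l))))
        \<le> flow_gf n j N (y(j := 1 / t))" .
    have "(\<Prod>l\<in>{j<..n}. geo_ent (\<phi> (j, l)) * (t * y l) powr \<phi> (j, l)) \<le> (\<Prod>l\<in>{j<..n}. 1 / (1 - t * y l))"
      using lt1 t y \<phi> by (intro prod_mono conjI geometric_series_ge_geo_ent)
        (auto intro!: mult_nonneg_nonneg less_imp_le[OF geo_ent_pos])
    also have "(\<Prod>l\<in>{j<..n}. geo_ent (\<phi> (j, l)) * (t * y l) powr \<phi> (j, l))
      = G * (t powr (\<Sum>l\<in>{Suc j..n}. \<phi> (j, l)) * (\<Prod>l\<in>{Suc j..n}. y l powr \<phi> (j, l)))"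
    proof -
      have "(\<Prod>l\<in>{Suc j..n}. (t * y l) powr \<phi> (j, l))
          = (\<Prod>l\<in>{Suc j..n}. t powr \<phi> (j, l)) * (\<Prod>l\<in>{Suc j..n}. y l powr \<phi> (j, l))"
        unfolding prod.distrib[symmetric] using t y by (intro prod.cong) (simp_all add: powr_mult less_imp_le)
      also have "(\<Prod>l\<in>{Suc j..n}. t powr \<phi> (j, l)) = t powr (\<Sum>l\<in>{Suc j..n}. \<phi> (j, l))"
        using t by (simp add: powr_sum)
      finally show ?thesis by (simp add: G_def I prod.distrib)
    qed
    finally have 2: "G * (t powr (\<Sum>l\<in>{Suc j..n}. \<phi> (j, l)) * (\<Prod>l\<in>{Suc j..n}. y l powr \<phi> (j, l)))
        \<le> (\<Prod>l\<in>{j<..n}. 1 / (1 - t * y l))" .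
    have Y: "Y = (\<Prod>l\<in>{Suc j..n}. y l powr \<phi> (j, l)) * (\<Prod>l\<in>{Suc j..n}. y l powr (\<Sum>i<j. \<phi> (i, l)))"
      unfolding Y_def prod.distrib[symmetric] by (intro prod.cong) (simp_all add: powr_add)
    have "t ^ m = t powr ((\<Sum>l\<in>{Suc j..n}. \<phi> (j, l)) + real S + - inn)"
      using t m_eq by (simp add: powr_realpow[symmetric])
    then have T: "t ^ m = t powr (\<Sum>l\<in>{Suc j..n}. \<phi> (j, l)) * t ^ S * t powr (- inn)"
      using t by (simp only: powr_add powr_realpow)
    have "A * G * Y * t ^ m = G * (t powr (\<Sum>l\<in>{Suc j..n}. \<phi> (j, l)) * (\<Prod>l\<in>{Suc j..n}. y l powr \<phi> (j, l)))
        * (t ^ S * (A * (t powr (- inn) * (\<Prod>l\<in>{Suc j..n}. y l powr (\<Sum>i<j. \<phi> (i, l))))))"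
      unfolding T Y by (simp add: mult_ac)
    also have "\<dots> \<le> (\<Prod>l\<in>{j<..n}. 1 / (1 - t * y l)) * (t ^ S * flow_gf n j N (y(j := 1 / t)))"
    proof (rule mult_mono[OF 2 mult_left_mono[OF 1]])
      show "0 \<le> (\<Prod>l\<in>{j<..n}. 1 / (1 - t * y l))" using lt1 by (intro prod_nonneg) (auto simp: less_imp_le)
      show "0 \<le> t ^ S * (A * (t powr (- inn) * (\<Prod>l\<in>{Suc j..n}. y l powr (\<Sum>i<j. \<phi> (i, l)))))"
        using t A by (auto intro!: mult_nonneg_nonneg prod_nonneg)
    qed (use t in auto)
    finally show "A * G * Y * t ^ m \<le> (\<Prod>l\<in>{j<..n}. 1 / (1 - t * y l)) * (t ^ S * flow_gf n j N (y(j := 1 / t)))" .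
  qed
  moreover have "(\<Prod>k<Suc j. 1 / geo_ent (\<Sum>i<Suc k. real_of_int (N i))) * (\<Prod>i<Suc j. \<Prod>l\<in>{i<..n}. geo_ent (\<phi> (i, l))) * Y
      = A * G * Y / geo_ent (real m)"
    unfolding A_def G_def real_m by (simp add: mult_ac)
  ultimately show ?case unfolding Y_def by simp
qed

text \<open>The condition at the last vertex \<open>n\<close> follows from the others by the cut
  identity, as the entries of \<open>N\<close> add up to 0.\<close>

lemma flows_eq_kostant_vectors:
  assumes "N n = - (\<Sum>i<n. N i)"
  shows "flows n n N = kostant_vectors n N"
proof (intro equalityI subsetI)
  fix f assume f: "f \<in> flows n n N"
  have "(\<Sum>i<n. N i) = (\<Sum>i<n. int (f (i, n)))" using flows_cut[OF f, of n] by simp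
  then have "(\<Sum>j\<in>{i<..n}. int (f (i, j))) - (\<Sum>k<i. int (f (k, i))) = N i" if "i \<le> n" for i
    using that f assms by (cases "i = n") (auto simp: flows_def)
  then show "f \<in> kostant_vectors n N"
    using f by (auto simp: kostant_vectors_def flows_def edges_iff)
next
  fix f assume "f \<in> kostant_vectors n N"
  then show "f \<in> flows n n N"
    by (auto simp: kostant_vectors_def flows_def edges_iff)
qed

lemma kostant_K_ge:
  fixes N :: "nat \<Rightarrow> int" and \<phi> :: "nat \<times> nat \<Rightarrow> real"
  assumes "\<And>e. \<phi> e \<ge> 0"
    and "\<And>i. i < n \<Longrightarrow> (\<Sum>l\<in>{i<..n}. \<phi> (i, l)) - (\<Sum>k<i. \<phi> (k, i)) = real_of_int (N i)"
    and "N n = - (\<Sum>i<n. N i)"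
  shows "(\<Prod>k<n. 1 / geo_ent (\<Sum>i\<le>k. real_of_int (N i))) * (\<Prod>i<n. \<Prod>l\<in>{i<..n}. geo_ent (\<phi> (i, l)))
     \<le> real (kostant_K n N)"
  using flow_gf_ge[of \<phi> n N n "\<lambda>_. 1"] assms
  by (simp add: flow_gf_def kostant_K_def flows_eq_kostant_vectors lessThan_Suc_atMost
      del: sum.lessThan_Suc)

section \<open>The evenly splitting flow\<close>

lemma geo_ent_ge: "x \<ge> 0 \<Longrightarrow> x + 1 \<le> geo_ent x"
proof (cases "x = 0")
  case False
  assume "x \<ge> 0"
  then have x: "x > 0" using False by simp
  have "x * ln x \<le> x * ln (x + 1)" using x by (intro mult_left_mono) auto
  then have "ln (x + 1) \<le> (x + 1) * ln (x + 1) - x * ln x" by (simp add: distrib_right)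
  then have "exp (ln (x + 1)) \<le> exp ((x + 1) * ln (x + 1) - x * ln x)"
    by (simp only: exp_le_cancel_iff)
  then show ?thesis using x by (simp add: geo_ent_exp)
qed simp

lemma geo_ent_le: "x \<ge> 0 \<Longrightarrow> geo_ent x \<le> exp 1 * (x + 1)"
proof (cases "x = 0")
  case False
  assume "x \<ge> 0"
  then have x: "x > 0" using False by simp
  have "x * ln ((x + 1) / x) \<le> x * ((x + 1) / x - 1)"
    using x by (intro mult_left_mono ln_le_minus_one) auto
  also have "\<dots> = 1" using x by (simp add: field_simps)
  finally have "x * (ln (x + 1) - ln x) \<le> 1" using x by (simp add: ln_div)
  then have "exp ((x + 1) * ln (x + 1) - x * ln x) \<le> exp (1 + ln (x + 1))"
    by (simp add: algebra_simps)
  then show ?thesis using x by (simp add: geo_ent_exp exp_add)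
qed simp

text \<open>Used with x = k = n - i, a = N_i and T = s_{i-1}: c_k over a common denominator, the
  recurrence for the inflow, and conservation at vertex \<open>i\<close>.\<close>

lemma flow_frac:
  fixes x a b T :: real
  assumes "x > 0"
  shows "a / (x + 1) + b / (x * (x + 1)) = (x * a + b) / (x * (x + 1))"
    and "T / (x + 1) + (a / (x + 1) + (T + a) / (x * (x + 1))) = (T + a) / x"
    and "x * (a / (x + 1) + (T + a) / (x * (x + 1))) - T / (x + 1) = a"
proof -
  have x: "x \<noteq> 0" "x + 1 \<noteq> 0" using assms by auto
  show "a / (x + 1) + b / (x * (x + 1)) = (x * a + b) / (x * (x + 1))"
    using x by (simp add: divide_simps)
  show "T / (x + 1) + (a / (x + 1) + (T + a) / (x * (x + 1))) = (T + a) / x"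
    using x by (simp add: divide_simps) (simp add: algebra_simps)
  show "x * (a / (x + 1) + (T + a) / (x * (x + 1))) - T / (x + 1) = a"
    using x by (simp add: divide_simps) (simp add: algebra_simps)
qed

theorem theorem5p5:
  fixes n :: nat and N :: "nat \<Rightarrow> int" and s :: "nat \<Rightarrow> int" and c :: "nat \<Rightarrow> real"
  assumes "n \<ge> 1"
    and "N n = - (\<Sum>i<n. N i)"
    and "s = (\<lambda>k. \<Sum>j\<le>k. N j)"
    and "c = (\<lambda>k. real_of_int (N (n - k)) / real (k + 1)
                  + real_of_int (s (n - k)) / real (k * (k + 1)))"
  shows "((\<forall>k<n. s k \<ge> max 0 (- int (n - k) * N k)) \<longrightarrow>
            real (kostant_K n N) \<ge>
              1 / real (n ^ 2)
              * (\<Prod>k<n. selfpow (real_of_int (s k)) / selfpow (1 + real_of_int (s k)))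
              * (\<Prod>k\<in>{1..n}. (selfpow (c k + 1) / selfpow (c k)) ^ k))
       \<and> ((\<forall>k<n. s k \<ge> max 0 (- int (n - k) * N k)
                 \<and> real_of_int (N k) \<ge> 1 / real (n - k) - real (n - k + 1)) \<longrightarrow>
            real (kostant_K n N) \<ge>
              1 / (real (n ^ 2) * exp (real n) * (fact n) ^ 2)
              * (\<Prod>k\<in>{1..n}. (selfpow (c k + 1) / selfpow (c k)) ^ (k - 1)))"
proof -
  note n = assms(1) and N_n = assms(2) and s_def = assms(3) and c_def = assms(4)
  define L where "L = (\<Prod>k\<in>{1..n}. 1 / geo_ent (s (n - k)) * geo_ent (c k) ^ k)"
  have s_eq: "real_of_int (s k) = (\<Sum>i\<le>k. real_of_int (N i))" for k by (simp add: s_def)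
  have reindex: "(\<Prod>k<n. h k) = (\<Prod>k\<in>{1..n}. h (n - k))" for h :: "nat \<Rightarrow> real"
    by (rule prod.reindex_bij_witness[where i = "\<lambda>k. n - k" and j = "\<lambda>k. n - k"]) auto
  have c_eq: "c k = N (n - k) / (real k + 1) + s (n - k) / (real k * (real k + 1))" for k
    by (simp add: c_def algebra_simps)
  have c_nonneg: "c k \<ge> 0" if "k \<in> {1..n}" and *: "\<forall>k<n. s k \<ge> max 0 (- int (n - k) * N k)" for k
  proof -
    have nk: "n - k < n" "n - (n - k) = k" using that by auto
    have "s (n - k) \<ge> - int k * N (n - k)"
      using *[rule_format, OF nk(1)] unfolding nk(2) by (rule max.boundedE)
    then have "int k * N (n - k) + s (n - k) \<ge> 0" by simp
    then have "real k * real_of_int (N (n - k)) + real_of_int (s (n - k)) \<ge> 0"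
      by (metis of_int_0_le_iff of_int_add of_int_mult of_int_of_nat_eq)
    moreover have "c k = (real k * real_of_int (N (n - k)) + real_of_int (s (n - k))) / (real k * (real k + 1))"
      unfolding c_eq using that by (intro flow_frac) simp
    ultimately show ?thesis by simp
  qed
  have main: "L \<le> real (kostant_K n N)" if *: "\<forall>k<n. s k \<ge> max 0 (- int (n - k) * N k)"
  proof -
    \<comment> \<open>\<open>c\<^sub>k\<close> is the flow on each edge leaving \<open>n - k\<close> when every vertex splits evenly.\<close>
    define \<phi> where "\<phi> e = (if fst e < n then c (n - fst e) else 0)" for e :: "nat \<times> nat"
    \<comment> \<open>The flow s_{i-1} across the cut before \<open>i\<close> reaches the n - i + 1
      vertices from \<open>i\<close> to \<open>n\<close> in equal shares.\<close>
    have inflow: "(\<Sum>k<i. c (n - k)) = (\<Sum>i'<i. real_of_int (N i')) / real (n - i + 1)" if "i \<le> n" for i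
      using that
    proof (induction i)
      case (Suc i)
      define k where "k = n - i"
      define T where "T = (\<Sum>i'<i. real_of_int (N i'))"
      have k: "k > 0" "n - Suc i + 1 = k" "n - k = i" using Suc.prems by (auto simp: k_def)
      have "c k = real_of_int (N i) / (real k + 1) + (T + N i) / (real k * (real k + 1))"
        unfolding c_eq s_eq k(3) by (simp add: T_def lessThan_Suc_atMost[symmetric])
      then have "T / (real k + 1) + c k = (T + N i) / real k"
        using k(1) flow_frac(2) by simp
      then show ?case using Suc k by (simp add: k_def[symmetric] T_def[symmetric] add_ac)
    qed simp
    have "(\<Prod>k<n. 1 / geo_ent (\<Sum>i\<le>k. real_of_int (N i))) * (\<Prod>i<n. \<Prod>l\<in>{i<..n}. geo_ent (\<phi> (i, l)))
        \<le> real (kostant_K n N)"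
    proof (rule kostant_K_ge[OF _ _ N_n])
      show "\<phi> e \<ge> 0" for e using c_nonneg[OF _ *] by (auto simp: \<phi>_def)
      fix i assume i: "i < n"
      define k where "k = n - i"
      define T where "T = (\<Sum>i'<i. real_of_int (N i'))"
      have k: "k > 0" "n - k = i" using i by (auto simp: k_def)
      have "c k = real_of_int (N i) / (real k + 1) + (T + N i) / (real k * (real k + 1))"
        unfolding c_eq s_eq k(2) by (simp add: T_def lessThan_Suc_atMost[symmetric])
      then have "real k * c k - T / (real k + 1) = N i"
        using k(1) flow_frac(3) by simp
      moreover have "(\<Sum>l\<in>{i<..n}. \<phi> (i, l)) = real k * c k" using i by (simp add: \<phi>_def k_def)
      moreover have "(\<Sum>k<i. \<phi> (k, i)) = (\<Sum>k<i. c (n - k))"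
        using i by (intro sum.cong) (auto simp: \<phi>_def)
      ultimately show "(\<Sum>l\<in>{i<..n}. \<phi> (i, l)) - (\<Sum>k<i. \<phi> (k, i)) = real_of_int (N i)"
        using inflow[of i] i by (simp add: k_def[symmetric] T_def[symmetric] add_ac)
    qed
    also have "(\<Prod>i<n. \<Prod>l\<in>{i<..n}. geo_ent (\<phi> (i, l))) = (\<Prod>i<n. geo_ent (c (n - i)) ^ (n - i))"
      by (intro prod.cong) (auto simp: \<phi>_def)
    finally show ?thesis
      by (simp add: L_def reindex s_eq[symmetric] prod.distrib[symmetric])
  qed
  have L_pos: "L > 0" unfolding L_def by (intro prod_pos) (simp add: geo_ent_pos)
  have n2: "L * (1 / real (n ^ 2)) \<le> L"
    using n L_pos by (intro mult_right_le_one_le) (auto simp: divide_simps)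
  show ?thesis
  proof (intro conjI impI)
    assume *: "\<forall>k<n. s k \<ge> max 0 (- int (n - k) * N k)"
    have "(\<Prod>k<n. selfpow (real_of_int (s k)) / selfpow (1 + real_of_int (s k)))
        * (\<Prod>k\<in>{1..n}. (selfpow (c k + 1) / selfpow (c k)) ^ k) = L"
      unfolding L_def reindex prod.distrib[symmetric]
      by (intro prod.cong) (simp_all add: geo_ent_def add.commute)
    then have "1 / real (n ^ 2)
              * (\<Prod>k<n. selfpow (real_of_int (s k)) / selfpow (1 + real_of_int (s k)))
              * (\<Prod>k\<in>{1..n}. (selfpow (c k + 1) / selfpow (c k)) ^ k) = L * (1 / real (n ^ 2))"
      by simp
    then show "real (kostant_K n N) \<ge> 1 / real (n ^ 2)
              * (\<Prod>k<n. selfpow (real_of_int (s k)) / selfpow (1 + real_of_int (s k)))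
              * (\<Prod>k\<in>{1..n}. (selfpow (c k + 1) / selfpow (c k)) ^ k)"
      using n2 main[OF *] by linarith
  next
    assume **: "\<forall>k<n. s k \<ge> max 0 (- int (n - k) * N k)
                 \<and> real_of_int (N k) \<ge> 1 / real (n - k) - real (n - k + 1)"
    then have *: "\<forall>k<n. s k \<ge> max 0 (- int (n - k) * N k)" by blast
    \<comment> \<open>Chosen so that c_k + 1 \<ge> (s_{n-k} + 1) / d_k. For k = n the formula
      collapses to c_n = s_0 / n, because N_0 = s_0; with d_n = n the product is (n-1)! n! n =
      (n!)^2.\<close>
    define d where "d k = (if k = n then real n else real k * (real k + 1))" for k
    define g where "g = (\<lambda>k. selfpow (c k + 1) / selfpow (c k))"
    have g: "g k = geo_ent (c k)" for k by (simp add: g_def geo_ent_def)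
    obtain p where p: "n = Suc p" using n by (cases n) auto
    have "(\<Prod>k\<in>{1..q}. real k * (real k + 1)) = fact q * fact (Suc q)" for q
      by (induction q) (auto simp: algebra_simps)
    moreover have "(\<Prod>k\<in>{1..p}. d k) = (\<Prod>k\<in>{1..p}. real k * (real k + 1))"
      by (intro prod.cong) (auto simp: d_def p)
    ultimately have d_prod: "(\<Prod>k\<in>{1..n}. d k) = (fact n)\<^sup>2"
      by (simp add: p d_def power2_eq_square algebra_simps)
    \<comment> \<open>One of the k factors g(c_k) pays for 1 / g(s_{n-k}), by x + 1 \<le> g(x) \<le>
      e (x + 1). This leaves the exponent k - 1 and costs a factor 1 / e for each k.\<close>
    have factor: "exp (- 1) / d k \<le> geo_ent (c k) / geo_ent (s (n - k))" if k: "k \<in> {1..n}" for k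
    proof -
      have s0: "s (n - k) \<ge> 0" using * k by auto
      have "(s (n - k) + 1) / d k \<le> c k + 1"
      proof (cases "k = n")
        case True
        then have "c k = s (n - k) / real n"
          unfolding c_eq using n flow_frac(2)[of "real n" 0 "real_of_int (N 0)"] by (simp add: s_def)
        then have "c k + 1 = (s (n - k) + real n) / d k"
          using n True by (simp add: d_def add_divide_distrib)
        then show ?thesis using True n by (simp add: d_def divide_right_mono)
      next
        case False
        \<comment> \<open>Multiplied by k, the lower bound on N_{n-k} reads k N_{n-k} + k (k + 1)
          \<ge> 1, which supplies the 1 in s_{n-k} + 1.\<close>
        have "real_of_int (N (n - k)) \<ge> 1 / real k - real (k + 1)"
          using ** k by (metis One_nat_def Suc_le_eq atLeastAtMost_iff diff_diff_cancel diff_less order_less_le_trans)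
        then have "real k * real_of_int (N (n - k)) \<ge> real k * (1 / real k - real (k + 1))"
          by (intro mult_left_mono) auto
        then have "1 \<le> real k * real_of_int (N (n - k)) + real k * (real k + 1)"
          using k by (simp add: algebra_simps)
        moreover have "c k + 1 = (real k * real_of_int (N (n - k)) + real k * (real k + 1) + s (n - k)) / d k"
        proof -
          have "real k * (real k + 1) \<noteq> 0" using k by simp
          moreover have "c k = (real k * real_of_int (N (n - k)) + s (n - k)) / (real k * (real k + 1))"
            unfolding c_eq using k by (intro flow_frac) simp
          ultimately show ?thesis using False by (simp add: d_def add_divide_distrib)
        qed
        ultimately show ?thesis using k False by (auto simp: d_def intro!: divide_right_mono)
      qed
      also have "\<dots> \<le> geo_ent (c k)" using c_nonneg[OF k *] by (rule geo_ent_ge)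
      finally have 1: "(s (n - k) + 1) / d k \<le> geo_ent (c k)" .
      have "exp (- 1) / d k = (s (n - k) + 1) / d k / (exp 1 * (s (n - k) + 1))"
      proof -
        have "real_of_int (s (n - k)) + 1 \<noteq> 0" using s0 by linarith
        then show ?thesis by (simp add: exp_minus divide_simps)
      qed
      also have "\<dots> \<le> geo_ent (c k) / geo_ent (s (n - k))"
        using s0 1 geo_ent_le[of "s (n - k)"]
        by (intro frac_le) (auto simp: geo_ent_pos less_imp_le)
      finally show ?thesis .
    qed
    have "exp (- real n) / (fact n)\<^sup>2 * (\<Prod>k\<in>{1..n}. g k ^ (k - 1))
        = (\<Prod>k\<in>{1..n}. exp (- 1) / d k * g k ^ (k - 1))"
      unfolding d_prod[symmetric]
      by (simp add: prod.distrib prod_dividef exp_of_nat_mult[symmetric])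
    also have "\<dots> \<le> (\<Prod>k\<in>{1..n}. geo_ent (c k) / geo_ent (s (n - k)) * g k ^ (k - 1))"
      using factor by (intro prod_mono conjI mult_right_mono)
        (auto simp: g d_def geo_ent_pos less_imp_le intro!: mult_nonneg_nonneg)
    also have "\<dots> = L"
      unfolding L_def g by (intro prod.cong refl) (auto simp: power_eq_if)
    finally have "exp (- real n) / (fact n)\<^sup>2 * (\<Prod>k\<in>{1..n}. g k ^ (k - 1)) * (1 / real (n ^ 2))
        \<le> L * (1 / real (n ^ 2))"
      by (intro mult_right_mono) auto
    also have "exp (- real n) / (fact n)\<^sup>2 * (\<Prod>k\<in>{1..n}. g k ^ (k - 1)) * (1 / real (n ^ 2))
        = 1 / (real (n ^ 2) * exp (real n) * (fact n) ^ 2) * (\<Prod>k\<in>{1..n}. g k ^ (k - 1))"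
      by (simp add: exp_minus divide_simps)
    finally show "real (kostant_K n N) \<ge>
              1 / (real (n ^ 2) * exp (real n) * (fact n) ^ 2)
              * (\<Prod>k\<in>{1..n}. (selfpow (c k + 1) / selfpow (c k)) ^ (k - 1))"
      using n2 main[OF *] unfolding g_def by linarith
  qed
qed

end
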